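(* Consider a symmetric, irreducible, aperiodic random walk on a countable group $\Gamma$, with Markov operator $\mathbb P$ on $\ell^2(\Gamma)$, and let $R$ be the radius of convergence of its Green's functions. Then there exists $\varepsilon>0$ such that the spectrum of $\mathbb P$ is contained in the interval $[-R^{-1}(1+\varepsilon)^{-1},R^{-1}]$. Consequently, for all $x,y\in\Gamma$ the Green's function $z\mapsto G_z(x,y)$ extends holomorphically to the doubly slit plane $\mathbb C\setminus\big((-\infty,-R(1+\varepsilon)]\cup[R,\infty)\big)$.
   Context: A (right) random walk on $\Gamma$ is a Markov chain $X_n=x\xi_1\cdots\xi_n$ with $\xi_i$ i.i.d. $\Gamma$-valued; $p(x,y)=P(\xi_1=x^{-1}y)$ and $p^n(x,y)=P^x\{X_n=y\}$. It is symmetric if the law of $\xi_1$ is invariant under $x\mapsto x^{-1}$, irreducible if the semigroup generated by the support of this law is $\Gamma$, and aperiodic if $\gcd\{n\ge1:p^n(1,1)>0\}=1$. The Green's function is $G_z(x,y)=\sum_{n\ge0}z^np^n(x,y)$, with radius of convergence $R$ independent of $x,y$. The Markov operator is $\mathbb Pu(x)=\sum_y p(x,y)u(y)$ on $\ell^2(\Gamma)$; it is bounded and self-adjoint. *)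

theory Defs
  imports
    "HOL-Probability.Probability"
    "HOL-Complex_Analysis.Complex_Analysis"
    "HOL-Algebra.Group"
begin

section \<open>Random walks on a group\<close>

text \<open>The law \<open>\<mu>\<close> of the increments is a \<open>pmf\<close> on the underlying type whose support lies in
  \<open>carrier G\<close>; \<open>replicate_pmf n \<mu>\<close> is the law of the i.i.d. family \<open>(\<xi>\<^sub>1, \<dots>, \<xi>\<^sub>n)\<close>, so
  \<open>walk_law G \<mu> n x\<close> is the law of \<open>X\<^sub>n = x \<otimes> \<xi>\<^sub>1 \<otimes> \<dots> \<otimes> \<xi>\<^sub>n\<close>.\<close>

definition walk_law :: "('a, 'b) monoid_scheme \<Rightarrow> 'a pmf \<Rightarrow> nat \<Rightarrow> 'a \<Rightarrow> 'a pmf" where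
  "walk_law G \<mu> n x = map_pmf (foldl (\<lambda>g h. g \<otimes>\<^bsub>G\<^esub> h) x) (replicate_pmf n \<mu>)"

definition step_prob :: "('a, 'b) monoid_scheme \<Rightarrow> 'a pmf \<Rightarrow> 'a \<Rightarrow> 'a \<Rightarrow> real" where
  "step_prob G \<mu> x y = pmf \<mu> (inv\<^bsub>G\<^esub> x \<otimes>\<^bsub>G\<^esub> y)"

definition walk_prob :: "('a, 'b) monoid_scheme \<Rightarrow> 'a pmf \<Rightarrow> nat \<Rightarrow> 'a \<Rightarrow> 'a \<Rightarrow> real" where
  "walk_prob G \<mu> n x y = pmf (walk_law G \<mu> n x) y"

definition symmetric_walk :: "('a, 'b) monoid_scheme \<Rightarrow> 'a pmf \<Rightarrow> bool" where
  "symmetric_walk G \<mu> \<longleftrightarrow> map_pmf (\<lambda>g. inv\<^bsub>G\<^esub> g) \<mu> = \<mu>"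

inductive_set semigroup_generated :: "('a, 'b) monoid_scheme \<Rightarrow> 'a set \<Rightarrow> 'a set"
  for G and S where
  incl: "g \<in> S \<Longrightarrow> g \<in> semigroup_generated G S"
| mult: "g \<in> semigroup_generated G S \<Longrightarrow> h \<in> semigroup_generated G S
          \<Longrightarrow> g \<otimes>\<^bsub>G\<^esub> h \<in> semigroup_generated G S"

definition irreducible_walk :: "('a, 'b) monoid_scheme \<Rightarrow> 'a pmf \<Rightarrow> bool" where
  "irreducible_walk G \<mu> \<longleftrightarrow> semigroup_generated G (set_pmf \<mu>) = carrier G"

definition aperiodic_walk :: "('a, 'b) monoid_scheme \<Rightarrow> 'a pmf \<Rightarrow> bool" where
  "aperiodic_walk G \<mu> \<longleftrightarrow> Gcd {n. n \<ge> 1 \<and> walk_prob G \<mu> n \<one>\<^bsub>G\<^esub> \<one>\<^bsub>G\<^esub> > 0} = 1"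

definition green :: "('a, 'b) monoid_scheme \<Rightarrow> 'a pmf \<Rightarrow> complex \<Rightarrow> 'a \<Rightarrow> 'a \<Rightarrow> complex" where
  "green G \<mu> z x y = (\<Sum>n. z ^ n * complex_of_real (walk_prob G \<mu> n x y))"

text \<open>The radius is taken at \<open>(\<one>, \<one>)\<close>. For irreducible walks it is finite and the same for all
  pairs of points; see \<open>conv_radius_green\<close> below.\<close>

definition green_radius :: "('a, 'b) monoid_scheme \<Rightarrow> 'a pmf \<Rightarrow> real" where
  "green_radius G \<mu> =
     real_of_ereal (conv_radius (\<lambda>n. complex_of_real (walk_prob G \<mu> n \<one>\<^bsub>G\<^esub> \<one>\<^bsub>G\<^esub>)))"


section \<open>The space \<open>\<ell>\<^sup>2(A)\<close> and spectra of operators on it\<close>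

text \<open>Elements of \<open>\<ell>\<^sup>2(A)\<close> are represented by functions on the whole type vanishing off \<open>A\<close>.\<close>

definition ell2 :: "'a set \<Rightarrow> ('a \<Rightarrow> complex) set" where
  "ell2 A = {u. (\<forall>x. x \<notin> A \<longrightarrow> u x = 0) \<and> (\<lambda>x. (cmod (u x))\<^sup>2) summable_on A}"

definition ell2_norm :: "'a set \<Rightarrow> ('a \<Rightarrow> complex) \<Rightarrow> real" where
  "ell2_norm A u = sqrt (\<Sum>\<^sub>\<infinity>x\<in>A. (cmod (u x))\<^sup>2)"

definition bounded_operator :: "'a set \<Rightarrow> (('a \<Rightarrow> complex) \<Rightarrow> 'a \<Rightarrow> complex) \<Rightarrow> bool" where
  "bounded_operator A T \<longleftrightarrow>
     (\<forall>u\<in>ell2 A. T u \<in> ell2 A) \<and>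
     (\<forall>u\<in>ell2 A. \<forall>v\<in>ell2 A. T (\<lambda>x. u x + v x) = (\<lambda>x. T u x + T v x)) \<and>
     (\<forall>c. \<forall>u\<in>ell2 A. T (\<lambda>x. c * u x) = (\<lambda>x. c * T u x)) \<and>
     (\<exists>K. \<forall>u\<in>ell2 A. ell2_norm A (T u) \<le> K * ell2_norm A u)"

text \<open>The resolvent set consists of those \<open>\<zeta>\<close> for which \<open>\<zeta>I - T\<close> has a bounded two-sided
  inverse \<open>S\<close> on \<open>\<ell>\<^sup>2(A)\<close>.\<close>

definition resolvent_set :: "'a set \<Rightarrow> (('a \<Rightarrow> complex) \<Rightarrow> 'a \<Rightarrow> complex) \<Rightarrow> complex set" where
  "resolvent_set A T =
     {\<zeta>. \<exists>S. bounded_operator A S \<and>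
        (\<forall>u\<in>ell2 A. S (\<lambda>x. \<zeta> * u x - T u x) = u \<and> (\<lambda>x. \<zeta> * S u x - T (S u) x) = u)}"

definition spectrum :: "'a set \<Rightarrow> (('a \<Rightarrow> complex) \<Rightarrow> 'a \<Rightarrow> complex) \<Rightarrow> complex set" where
  "spectrum A T = - resolvent_set A T"

definition markov_operator ::
    "('a, 'b) monoid_scheme \<Rightarrow> 'a pmf \<Rightarrow> ('a \<Rightarrow> complex) \<Rightarrow> 'a \<Rightarrow> complex" where
  "markov_operator G \<mu> u x =
     (if x \<in> carrier G then \<Sum>\<^sub>\<infinity>y\<in>carrier G. complex_of_real (step_prob G \<mu> x y) * u y else 0)"


section \<open>Independence of the radius of convergence\<close>

lemma walk_law_0: "walk_law G \<mu> 0 x = return_pmf x"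
  by (simp add: walk_law_def)

lemma walk_law_Suc: "walk_law G \<mu> (Suc n) x = bind_pmf \<mu> (\<lambda>g. walk_law G \<mu> n (x \<otimes>\<^bsub>G\<^esub> g))"
  by (simp add: walk_law_def map_pmf_def bind_assoc_pmf bind_return_pmf)

lemma walk_law_add: "walk_law G \<mu> (m + n) x = bind_pmf (walk_law G \<mu> m x) (walk_law G \<mu> n)"
  by (induction m arbitrary: x) (simp_all add: walk_law_0 walk_law_Suc bind_return_pmf bind_assoc_pmf)

lemma walk_prob_one:
  assumes "group G" "set_pmf \<mu> \<subseteq> carrier G" "x \<in> carrier G" "y \<in> carrier G"
  shows "walk_prob G \<mu> 1 x y = step_prob G \<mu> x y"
proof -
  interpret group G by fact
  have eq: "{g \<in> set_pmf \<mu>. x \<otimes>\<^bsub>G\<^esub> g = y} = {inv\<^bsub>G\<^esub> x \<otimes>\<^bsub>G\<^esub> y} \<inter> set_pmf \<mu>"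
    using assms(2-4) by (auto simp: m_assoc[symmetric])
  have "walk_law G \<mu> 1 x = map_pmf (\<lambda>g. x \<otimes>\<^bsub>G\<^esub> g) \<mu>"
    by (simp add: walk_law_Suc walk_law_0 map_pmf_def)
  hence "walk_prob G \<mu> 1 x y = measure (measure_pmf \<mu>) {g. x \<otimes>\<^bsub>G\<^esub> g = y}"
    by (simp add: walk_prob_def pmf_map vimage_def)
  also have "\<dots> = measure (measure_pmf \<mu>) ({g. x \<otimes>\<^bsub>G\<^esub> g = y} \<inter> set_pmf \<mu>)"
    by (rule measure_Int_set_pmf[symmetric])
  also have "{g. x \<otimes>\<^bsub>G\<^esub> g = y} \<inter> set_pmf \<mu> = {inv\<^bsub>G\<^esub> x \<otimes>\<^bsub>G\<^esub> y} \<inter> set_pmf \<mu>"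
    using eq by blast
  also have "measure (measure_pmf \<mu>) \<dots> = step_prob G \<mu> x y"
    by (simp add: measure_Int_set_pmf step_prob_def measure_pmf_single)
  finally show ?thesis .
qed

lemma walk_prob_nonneg: "walk_prob G \<mu> n x y \<ge> 0"
  and walk_prob_le_1: "walk_prob G \<mu> n x y \<le> 1"
  by (simp_all add: walk_prob_def pmf_le_1)

lemma walk_prob_supermult:
  "walk_prob G \<mu> m x y * walk_prob G \<mu> n y z \<le> walk_prob G \<mu> (m + n) x z"
proof -
  let ?p = "walk_law G \<mu> m x" and ?f = "walk_law G \<mu> n"
  have "walk_prob G \<mu> m x y * walk_prob G \<mu> n y z
        = (\<integral>v. indicator {y} v * pmf (?f y) z \<partial>measure_pmf ?p)"
    by (simp add: walk_prob_def measure_pmf_single)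
  also have "\<dots> \<le> (\<integral>v. pmf (?f v) z \<partial>measure_pmf ?p)"
    by (intro integral_mono measure_pmf.integrable_const_bound[where B = 1])
       (auto simp: indicator_def pmf_le_1)
  also have "\<dots> = walk_prob G \<mu> (m + n) x z"
    by (simp add: walk_prob_def walk_law_add pmf_bind)
  finally show ?thesis .
qed

lemma walk_prob_pos_ex:
  assumes "group G" "irreducible_walk G \<mu>" "x \<in> carrier G" "y \<in> carrier G"
  shows "\<exists>n\<ge>1. walk_prob G \<mu> n x y > 0"
proof -
  interpret group G by fact
  have gen: "semigroup_generated G (set_pmf \<mu>) = carrier G"
    using assms(2) by (simp add: irreducible_walk_def)
  have *: "\<exists>n\<ge>1. walk_prob G \<mu> n x (x \<otimes>\<^bsub>G\<^esub> g) > 0"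
    if "g \<in> semigroup_generated G (set_pmf \<mu>)" "x \<in> carrier G" for g x
    using that
  proof (induction arbitrary: x rule: semigroup_generated.induct)
    case (incl g)
    have "x \<otimes>\<^bsub>G\<^esub> g \<in> set_pmf (walk_law G \<mu> 1 x)"
      using incl by (auto simp: walk_law_Suc walk_law_0)
    thus ?case
      by (intro exI[of _ 1]) (simp add: walk_prob_def pmf_positive)
  next
    case (mult g h)
    have gh: "g \<in> carrier G" "h \<in> carrier G"
      using mult.hyps gen by auto
    obtain m where m: "m \<ge> 1" "walk_prob G \<mu> m x (x \<otimes>\<^bsub>G\<^esub> g) > 0"
      using mult by blast
    obtain n where n: "n \<ge> 1" "walk_prob G \<mu> n (x \<otimes>\<^bsub>G\<^esub> g) (x \<otimes>\<^bsub>G\<^esub> g \<otimes>\<^bsub>G\<^esub> h) > 0"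
      using mult gh by (meson m_closed)
    have "0 < walk_prob G \<mu> m x (x \<otimes>\<^bsub>G\<^esub> g) * walk_prob G \<mu> n (x \<otimes>\<^bsub>G\<^esub> g) (x \<otimes>\<^bsub>G\<^esub> g \<otimes>\<^bsub>G\<^esub> h)"
      using m n by simp
    also have "\<dots> \<le> walk_prob G \<mu> (m + n) x (x \<otimes>\<^bsub>G\<^esub> g \<otimes>\<^bsub>G\<^esub> h)"
      by (rule walk_prob_supermult)
    finally show ?case
      using m gh mult.prems by (intro exI[of _ "m + n"]) (simp add: m_assoc)
  qed
  have "\<exists>n\<ge>1. walk_prob G \<mu> n x (x \<otimes>\<^bsub>G\<^esub> (inv\<^bsub>G\<^esub> x \<otimes>\<^bsub>G\<^esub> y)) > 0"
    by (rule *) (use gen assms in auto)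
  thus ?thesis
    using assms by (simp add: m_assoc[symmetric])
qed

lemma conv_radius_antimono:
  fixes f g :: "nat \<Rightarrow> complex"
  assumes "\<And>n. norm (f n) \<le> norm (g n)"
  shows "conv_radius g \<le> conv_radius f"
proof -
  have "root n (norm (f n)) \<le> root n (norm (g n))" for n
    by (cases "n = 0") (simp_all add: assms)
  hence "limsup (\<lambda>n. ereal (root n (norm (f n)))) \<le> limsup (\<lambda>n. ereal (root n (norm (g n))))"
    by (intro Limsup_mono always_eventually allI) simp
  moreover have "0 \<le> limsup (\<lambda>n. ereal (root n (norm (f n))))"
    by (rule le_Limsup) (simp_all add: real_root_pos_pos_le)
  ultimately show ?thesis
    unfolding conv_radius_def by (intro ereal_inverse_antimono)
qed

lemma conv_radius_walk_le:
  assumes "group G" "irreducible_walk G \<mu>"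
    and "x \<in> carrier G" "y \<in> carrier G" "x' \<in> carrier G" "y' \<in> carrier G"
  shows "conv_radius (\<lambda>n. complex_of_real (walk_prob G \<mu> n x y))
         \<le> conv_radius (\<lambda>n. complex_of_real (walk_prob G \<mu> n x' y'))"
proof -
  obtain a where a: "walk_prob G \<mu> a x x' > 0"
    using walk_prob_pos_ex assms by meson
  obtain b where b: "walk_prob G \<mu> b y' y > 0"
    using walk_prob_pos_ex assms by meson
  define c where "c = walk_prob G \<mu> a x x' * walk_prob G \<mu> b y' y"
  have "c > 0"
    using a b by (simp add: c_def)
  have le: "c * walk_prob G \<mu> n x' y' \<le> walk_prob G \<mu> (n + (a + b)) x y" for n
  proof -
    have "c * walk_prob G \<mu> n x' y'
          = walk_prob G \<mu> a x x' * walk_prob G \<mu> n x' y' * walk_prob G \<mu> b y' y"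
      by (simp add: c_def)
    also have "\<dots> \<le> walk_prob G \<mu> (a + n) x y' * walk_prob G \<mu> b y' y"
      by (intro mult_right_mono walk_prob_supermult walk_prob_nonneg)
    also have "\<dots> \<le> walk_prob G \<mu> (a + n + b) x y"
      by (rule walk_prob_supermult)
    finally show ?thesis
      by (simp add: ac_simps)
  qed
  have "conv_radius (\<lambda>n. complex_of_real (walk_prob G \<mu> n x y))
        = conv_radius (\<lambda>n. complex_of_real (walk_prob G \<mu> (n + (a + b)) x y))"
    by (rule conv_radius_shift[symmetric])
  also have "\<dots> \<le> conv_radius (\<lambda>n. complex_of_real c * complex_of_real (walk_prob G \<mu> n x' y'))"
  proof (rule conv_radius_antimono)
    fix n
    show "norm (complex_of_real c * complex_of_real (walk_prob G \<mu> n x' y'))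
          \<le> norm (complex_of_real (walk_prob G \<mu> (n + (a + b)) x y))"
      using le[of n] \<open>c > 0\<close> by (simp add: norm_mult walk_prob_nonneg)
  qed
  also have "\<dots> = conv_radius (\<lambda>n. complex_of_real (walk_prob G \<mu> n x' y'))"
    using \<open>c > 0\<close> by (intro conv_radius_cmult_left) auto
  finally show ?thesis .
qed

theorem conv_radius_green:
  assumes "group G" "irreducible_walk G \<mu>" "x \<in> carrier G" "y \<in> carrier G"
  shows "conv_radius (\<lambda>n. complex_of_real (walk_prob G \<mu> n x y)) = ereal (green_radius G \<mu>)"
    and "green_radius G \<mu> \<ge> 1"
proof -
  interpret group G by fact
  let ?e = "\<one>\<^bsub>G\<^esub>"
  let ?R = "conv_radius (\<lambda>n. complex_of_real (walk_prob G \<mu> n ?e ?e))"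
  have ge: "?R \<ge> 1"
  proof -
    have "conv_radius (\<lambda>_. 1 :: complex) \<le> ?R"
      by (rule conv_radius_antimono) (simp add: walk_prob_nonneg walk_prob_le_1)
    moreover have "conv_radius (\<lambda>_. 1 :: complex) = 1"
      by (rule conv_radius_ratio_limit_nonzero[where c = 1]) (simp_all add: one_ereal_def)
    ultimately show ?thesis by simp
  qed
  obtain k where k: "k \<ge> 1" "walk_prob G \<mu> k ?e ?e > 0"
    using walk_prob_pos_ex[OF assms(1,2) one_closed one_closed] by blast
  define c where "c = walk_prob G \<mu> k ?e ?e"
  have c: "c > 0" using k by (simp add: c_def)
  have pow: "c ^ n \<le> walk_prob G \<mu> (k * n) ?e ?e" for n
  proof (induction n)
    case 0
    thus ?case by (simp add: walk_prob_def walk_law_0)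
  next
    case (Suc n)
    have "c ^ Suc n \<le> c * walk_prob G \<mu> (k * n) ?e ?e"
      using Suc c by simp
    also have "\<dots> \<le> walk_prob G \<mu> (k + k * n) ?e ?e"
      unfolding c_def by (rule walk_prob_supermult)
    finally show ?case by simp
  qed
  have fin: "?R \<noteq> \<infinity>"
  proof
    assume inf: "?R = \<infinity>"
    define z where "z = max 1 (1 / c)"
    have z: "z \<ge> 1" "c * z \<ge> 1" using c by (auto simp: z_def max_def field_simps)
    have "summable (\<lambda>n. complex_of_real (walk_prob G \<mu> n ?e ?e) * complex_of_real z ^ n)"
      by (rule summable_in_conv_radius) (simp add: inf)
    hence "(\<lambda>n. complex_of_real (walk_prob G \<mu> n ?e ?e) * complex_of_real z ^ n) \<longlonglongrightarrow> 0"
      by (rule summable_LIMSEQ_zero)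
    hence lim: "(\<lambda>n. walk_prob G \<mu> n ?e ?e * z ^ n) \<longlonglongrightarrow> 0"
      by (subst (asm) tendsto_norm_zero_iff[symmetric])
         (use z in \<open>simp add: norm_mult norm_power walk_prob_nonneg\<close>)
    have "strict_mono (\<lambda>n. k * n)"
      using k by (auto simp: strict_mono_def)
    from LIMSEQ_subseq_LIMSEQ[OF lim this]
    have lim': "(\<lambda>n. walk_prob G \<mu> (k * n) ?e ?e * z ^ (k * n)) \<longlonglongrightarrow> 0"
      by (simp add: o_def)
    have "1 \<le> walk_prob G \<mu> (k * n) ?e ?e * z ^ (k * n)" for n
    proof -
      have "1 \<le> (c * z) ^ n" using z by simp
      also have "\<dots> = c ^ n * z ^ n" by (simp add: power_mult_distrib)
      also have "\<dots> \<le> walk_prob G \<mu> (k * n) ?e ?e * z ^ (k * n)"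
        using k z c by (intro mult_mono pow power_increasing) (auto simp: walk_prob_nonneg)
      finally show ?thesis .
    qed
    hence "(1::real) \<le> 0"
      by (intro LIMSEQ_le_const[OF lim']) auto
    thus False by simp
  qed
  have R: "?R = ereal (green_radius G \<mu>)"
    unfolding green_radius_def using ge fin by (cases ?R) auto
  show "green_radius G \<mu> \<ge> 1"
    using ge R by simp
  show "conv_radius (\<lambda>n. complex_of_real (walk_prob G \<mu> n x y)) = ereal (green_radius G \<mu>)"
    using conv_radius_walk_le[OF assms one_closed one_closed]
      conv_radius_walk_le[OF assms(1,2) one_closed one_closed assms(3,4)] R
    by (metis antisym)
qed

end

theory Submission
  imports Defs
begin

text \<open>Write \<open>T\<close> for the Markov operator and \<open>\<rho> = 1/R\<close>.

  By symmetry \<open>T\<close> is self-adjoint, and \<open>\<parallel>T\<parallel> \<le> \<rho>\<close> (\<open>markov_operator_norm_le\<close>): for finitely supported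
  \<open>f\<close> the norms \<open>\<parallel>T\<^sup>n f\<parallel>\<close> are log-convex in \<open>n\<close>, so \<open>\<parallel>T f\<parallel> / \<parallel>f\<parallel>\<close> is at most their exponential growth
  rate, and \<open>\<parallel>T\<^sup>n f\<parallel>\<^sup>2 = \<langle>T\<^sup>2\<^sup>n f, f\<rangle>\<close> is a finite combination of transition probabilities, which grow at
  rate at most \<open>\<rho>\<^sup>2\<close> per step \<open>n\<close>. Hence the spectrum lies in \<open>[-\<rho>, \<rho>]\<close>.

  By aperiodicity there is an odd \<open>k\<close> with \<open>\<delta> = p\<^sup>k(1,1) > 0\<close>. The kernel of \<open>T\<^sup>k - \<delta> I\<close> is nonnegative,
  so \<open>\<bar>\<langle>(T\<^sup>k - \<delta>) u, u\<rangle>\<bar> \<le> \<langle>(T\<^sup>k - \<delta>) \<bar>u\<bar>, \<bar>u\<bar>\<rangle> \<le> (\<rho>\<^sup>k - \<delta>) \<parallel>u\<parallel>\<^sup>2\<close> and therefore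
  \<open>T\<^sup>k \<ge> -(\<rho>\<^sup>k - \<delta>)\<close> as a quadratic form (\<open>positive_diagonal_form_bound\<close>). If
  \<open>(\<rho> / (1 + \<epsilon>))\<^sup>k > \<rho>\<^sup>k - \<delta>\<close>, then for real \<open>t < -\<rho> / (1 + \<epsilon>)\<close> the operator \<open>T\<^sup>k - t\<^sup>k\<close> is coercive, and
  its factor \<open>t - T\<close> is invertible (\<open>real_power_form_bound_resolvent\<close>). All resolvents are obtained
  from coercivity by the Lax--Milgram argument (\<open>coercive_operator_surj\<close>, \<open>resolvent_setI_coercive\<close>),
  so no spectral theorem is needed.

  Finally \<open>G\<^sub>z(x,y) = ((I - zT)\<^sup>-\<^sup>1 1\<^sub>y)(x)\<close> for \<open>\<bar>z\<bar> < R\<close>, where \<open>1\<^sub>y\<close> is the indicator of \<open>{y}\<close>. The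
  right-hand side is defined and holomorphic wherever \<open>z = 0\<close> or \<open>1/z\<close> is outside the spectrum
  (\<open>inverse_family_holomorphic\<close>), which includes the doubly slit plane.\<close>

section \<open>The Hilbert space \<open>\<ell>\<^sup>2(A)\<close>\<close>

text \<open>The inner product of \<open>\<ell>\<^sup>2(A)\<close>, linear in the first argument.\<close>

definition ell2_inner :: "'a set \<Rightarrow> ('a \<Rightarrow> complex) \<Rightarrow> ('a \<Rightarrow> complex) \<Rightarrow> complex" where
  "ell2_inner A u v = (\<Sum>\<^sub>\<infinity>x\<in>A. u x * cnj (v x))"

lemma ell2_outside: "u \<in> ell2 A \<Longrightarrow> x \<notin> A \<Longrightarrow> u x = 0"
  by (simp add: ell2_def)

lemma ell2_norm_nonneg [simp]: "0 \<le> ell2_norm A u"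
  by (simp add: ell2_norm_def infsum_nonneg)

lemma ell2_norm_power2: "(ell2_norm A u)\<^sup>2 = (\<Sum>\<^sub>\<infinity>x\<in>A. (cmod (u x))\<^sup>2)"
  by (simp add: ell2_norm_def infsum_nonneg)

lemma L2_set_le_ell2_norm:
  assumes "u \<in> ell2 A" "finite F" "F \<subseteq> A"
  shows "L2_set (\<lambda>x. cmod (u x)) F \<le> ell2_norm A u"
proof -
  have "(\<Sum>x\<in>F. (cmod (u x))\<^sup>2) \<le> (\<Sum>\<^sub>\<infinity>x\<in>A. (cmod (u x))\<^sup>2)"
    using assms by (intro finite_sum_le_infsum) (auto simp: ell2_def)
  thus ?thesis by (simp add: L2_set_def ell2_norm_def)
qed

text \<open>A function belongs to \<open>\<ell>\<^sup>2(A)\<close> with norm at most \<open>C\<close> as soon as its restrictions to finite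
  subsets of \<open>A\<close> have Euclidean norm at most \<open>C\<close>. Norm inequalities thus reduce to finite sums, and
  pointwise limits of norm-bounded families stay in \<open>\<ell>\<^sup>2(A)\<close>.\<close>

lemma ell2_of_finite_bound:
  assumes "\<And>x. x \<notin> A \<Longrightarrow> u x = 0"
    and "\<And>F. finite F \<Longrightarrow> F \<subseteq> A \<Longrightarrow> L2_set (\<lambda>x. cmod (u x)) F \<le> C"
  shows "u \<in> ell2 A" and "ell2_norm A u \<le> C"
proof -
  have C: "C \<ge> 0" using assms(2)[of "{}"] by simp
  have le: "(\<Sum>x\<in>F. (cmod (u x))\<^sup>2) \<le> C\<^sup>2" if "finite F" "F \<subseteq> A" for F
    using assms(2)[OF that] unfolding L2_set_def by (simp add: sqrt_le_D)
  have s: "(\<lambda>x. (cmod (u x))\<^sup>2) summable_on A"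
    by (rule nonneg_bdd_above_summable_on) (auto intro!: bdd_aboveI2[where M = "C\<^sup>2"] le)
  show "u \<in> ell2 A" using s assms(1) by (simp add: ell2_def)
  have "(\<Sum>\<^sub>\<infinity>x\<in>A. (cmod (u x))\<^sup>2) \<le> C\<^sup>2"
    by (rule infsum_le_finite_sums[OF s le])
  thus "ell2_norm A u \<le> C"
    using C by (simp add: ell2_norm_def real_le_lsqrt)
qed

lemma cmod_le_ell2_norm:
  assumes "u \<in> ell2 A"
  shows "cmod (u x) \<le> ell2_norm A u"
proof (cases "x \<in> A")
  case True
  then show ?thesis using L2_set_le_ell2_norm[OF assms, of "{x}"] by simp
qed (use assms in \<open>simp add: ell2_outside\<close>)

lemma ell2_norm_eq_0_iff:
  assumes "u \<in> ell2 A"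
  shows "ell2_norm A u = 0 \<longleftrightarrow> u = (\<lambda>x. 0)"
proof
  assume "ell2_norm A u = 0"
  then show "u = (\<lambda>x. 0)"
    using cmod_le_ell2_norm[OF assms] by auto
qed (simp add: ell2_norm_def)

lemma ell2_zero [simp]: "(\<lambda>x. 0) \<in> ell2 A"
  by (simp add: ell2_def)

lemma ell2_norm_zero [simp]: "ell2_norm A (\<lambda>x. 0) = 0"
  by (simp add: ell2_norm_def)

lemma ell2_add:
  assumes "u \<in> ell2 A" "v \<in> ell2 A"
  shows ell2_add_mem: "(\<lambda>x. u x + v x) \<in> ell2 A"
    and ell2_norm_triangle: "ell2_norm A (\<lambda>x. u x + v x) \<le> ell2_norm A u + ell2_norm A v"
proof -
  have *: "L2_set (\<lambda>x. cmod (u x + v x)) F \<le> ell2_norm A u + ell2_norm A v"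
    if "finite F" "F \<subseteq> A" for F
  proof -
    have "L2_set (\<lambda>x. cmod (u x + v x)) F \<le> L2_set (\<lambda>x. cmod (u x) + cmod (v x)) F"
      by (intro L2_set_mono) (auto simp: norm_triangle_ineq)
    also have "\<dots> \<le> L2_set (\<lambda>x. cmod (u x)) F + L2_set (\<lambda>x. cmod (v x)) F"
      by (rule L2_set_triangle_ineq)
    also have "\<dots> \<le> ell2_norm A u + ell2_norm A v"
      using assms that by (intro add_mono L2_set_le_ell2_norm)
    finally show ?thesis .
  qed
  have z: "u x + v x = 0" if "x \<notin> A" for x
    using assms that by (simp add: ell2_outside)
  show "(\<lambda>x. u x + v x) \<in> ell2 A"
    by (rule ell2_of_finite_bound(1)[OF z *])
  show "ell2_norm A (\<lambda>x. u x + v x) \<le> ell2_norm A u + ell2_norm A v"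
    by (rule ell2_of_finite_bound(2)[OF z *])
qed

lemma ell2_norm_scale: "ell2_norm A (\<lambda>x. c * u x) = cmod c * ell2_norm A u"
  by (simp add: ell2_norm_def norm_mult power_mult_distrib infsum_cmult_right' real_sqrt_mult)

lemma ell2_scale: "u \<in> ell2 A \<Longrightarrow> (\<lambda>x. c * u x) \<in> ell2 A"
  by (auto simp: ell2_def norm_mult power_mult_distrib intro!: summable_on_cmult_right)

lemma ell2_uminus: "u \<in> ell2 A \<Longrightarrow> (\<lambda>x. - u x) \<in> ell2 A"
  by (simp add: ell2_def)

lemma ell2_diff: "u \<in> ell2 A \<Longrightarrow> v \<in> ell2 A \<Longrightarrow> (\<lambda>x. u x - v x) \<in> ell2 A"
  using ell2_add_mem[of u A "\<lambda>x. - v x"] by (simp add: ell2_uminus)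

lemma ell2_sum:
  assumes "\<And>i. i \<in> I \<Longrightarrow> u i \<in> ell2 A"
  shows "(\<lambda>x. \<Sum>i\<in>I. u i x) \<in> ell2 A"
  using assms by (induction I rule: infinite_finite_induct) (simp_all add: ell2_add_mem)

lemma ell2_norm_sum_le:
  assumes "\<And>i. i \<in> I \<Longrightarrow> u i \<in> ell2 A"
  shows "ell2_norm A (\<lambda>x. \<Sum>i\<in>I. u i x) \<le> (\<Sum>i\<in>I. ell2_norm A (u i))"
  using assms
proof (induction I rule: infinite_finite_induct)
  case (insert i I)
  have "ell2_norm A (\<lambda>x. u i x + (\<Sum>i\<in>I. u i x))
        \<le> ell2_norm A (u i) + ell2_norm A (\<lambda>x. \<Sum>i\<in>I. u i x)"
    using insert.prems by (intro ell2_norm_triangle ell2_sum) auto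
  with insert show ?case by auto
qed simp_all

lemma ell2_norm_mono:
  assumes "v \<in> ell2 A" "\<And>x. cmod (u x) \<le> cmod (v x)"
  shows "u \<in> ell2 A" "ell2_norm A u \<le> ell2_norm A v"
proof -
  have *: "L2_set (\<lambda>x. cmod (u x)) F \<le> ell2_norm A v" if "finite F" "F \<subseteq> A" for F
    using L2_set_le_ell2_norm[OF assms(1) that] assms(2)
    by (meson L2_set_mono norm_ge_zero order_trans)
  have "u x = 0" if "x \<notin> A" for x
    using assms(2)[of x] ell2_outside[OF assms(1) that] by simp
  then show "u \<in> ell2 A" by (rule ell2_of_finite_bound(1)[OF _ *])
  show "ell2_norm A u \<le> ell2_norm A v" by (rule ell2_of_finite_bound(2)[OF \<open>\<And>x. x \<notin> A \<Longrightarrow> u x = 0\<close> *])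
qed

text \<open>Completeness of \<open>\<ell>\<^sup>2(A)\<close>: an absolutely convergent series has its pointwise sum as limit.\<close>

lemma ell2_series:
  assumes w: "\<And>n. w n \<in> ell2 A" and s: "summable (\<lambda>n. ell2_norm A (w n))"
  shows ell2_suminf_mem: "(\<lambda>x. \<Sum>n. w n x) \<in> ell2 A"
    and ell2_norm_suminf_le: "ell2_norm A (\<lambda>x. \<Sum>n. w n x) \<le> (\<Sum>n. ell2_norm A (w n))"
proof -
  have sx: "summable (\<lambda>n. w n x)" for x
    by (rule summable_comparison_test'[OF s]) (simp add: cmod_le_ell2_norm w)
  have *: "L2_set (\<lambda>x. cmod (\<Sum>n. w n x)) F \<le> (\<Sum>n. ell2_norm A (w n))"
    if F: "finite F" "F \<subseteq> A" for F
  proof (rule LIMSEQ_le_const2)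
    show "(\<lambda>N. L2_set (\<lambda>x. cmod (\<Sum>n<N. w n x)) F) \<longlonglongrightarrow> L2_set (\<lambda>x. cmod (\<Sum>n. w n x)) F"
      unfolding L2_set_def by (intro tendsto_intros summable_LIMSEQ sx)
    show "\<exists>N. \<forall>n\<ge>N. L2_set (\<lambda>x. cmod (\<Sum>k<n. w k x)) F \<le> (\<Sum>n. ell2_norm A (w n))"
    proof (intro exI[of _ 0] allI impI)
      fix n
      have "L2_set (\<lambda>x. cmod (\<Sum>k<n. w k x)) F \<le> ell2_norm A (\<lambda>x. \<Sum>k<n. w k x)"
        using F w by (intro L2_set_le_ell2_norm ell2_sum)
      also have "\<dots> \<le> (\<Sum>k<n. ell2_norm A (w k))"
        by (rule ell2_norm_sum_le) (rule w)
      also have "\<dots> \<le> (\<Sum>n. ell2_norm A (w n))"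
        by (rule sum_le_suminf[OF s]) auto
      finally show "L2_set (\<lambda>x. cmod (\<Sum>k<n. w k x)) F \<le> (\<Sum>n. ell2_norm A (w n))" .
    qed
  qed
  have z: "(\<Sum>n. w n x) = 0" if "x \<notin> A" for x
    using ell2_outside[OF w that] by simp
  show "(\<lambda>x. \<Sum>n. w n x) \<in> ell2 A"
    by (rule ell2_of_finite_bound(1)[OF z *])
  show "ell2_norm A (\<lambda>x. \<Sum>n. w n x) \<le> (\<Sum>n. ell2_norm A (w n))"
    by (rule ell2_of_finite_bound(2)[OF z *])
qed

text \<open>The same series converges in norm.\<close>

lemma ell2_norm_tail:
  assumes w: "\<And>n. w n \<in> ell2 A" and s: "summable (\<lambda>n. ell2_norm A (w n))"
  shows "(\<lambda>N. ell2_norm A (\<lambda>x. (\<Sum>n. w n x) - (\<Sum>n<N. w n x))) \<longlonglongrightarrow> 0"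
proof (rule tendsto_sandwich)
  have sx: "summable (\<lambda>n. w n x)" for x
    by (rule summable_comparison_test'[OF s]) (simp add: cmod_le_ell2_norm w)
  have eq: "(\<lambda>x. (\<Sum>n. w n x) - (\<Sum>n<N. w n x)) = (\<lambda>x. \<Sum>n. w (n + N) x)" for N
    using suminf_split_initial_segment[OF sx, of _ N] by (auto simp: algebra_simps)
  show "\<forall>\<^sub>F N in sequentially. 0 \<le> ell2_norm A (\<lambda>x. (\<Sum>n. w n x) - (\<Sum>n<N. w n x))"
    by simp
  show "\<forall>\<^sub>F N in sequentially. ell2_norm A (\<lambda>x. (\<Sum>n. w n x) - (\<Sum>n<N. w n x))
          \<le> (\<Sum>n. ell2_norm A (w (n + N)))"
    unfolding eq by (intro always_eventually allI ell2_norm_suminf_le w)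
       (simp add: summable_iff_shift[of "\<lambda>n. ell2_norm A (w n)"] s)
  have "(\<lambda>N. (\<Sum>n. ell2_norm A (w n)) - (\<Sum>n<N. ell2_norm A (w n))) \<longlonglongrightarrow>
        (\<Sum>n. ell2_norm A (w n)) - (\<Sum>n. ell2_norm A (w n))"
    by (intro tendsto_intros summable_LIMSEQ s)
  moreover have "(\<lambda>N. (\<Sum>n. ell2_norm A (w n)) - (\<Sum>n<N. ell2_norm A (w n))) =
        (\<lambda>N. \<Sum>n. ell2_norm A (w (n + N)))"
    using suminf_split_initial_segment[OF s] by (auto simp: algebra_simps)
  ultimately show "(\<lambda>N. \<Sum>n. ell2_norm A (w (n + N))) \<longlonglongrightarrow> 0" by simp
qed auto

lemma ell2_inner_bound:
  assumes u: "u \<in> ell2 A" and v: "v \<in> ell2 A"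
  shows ell2_inner_abs_summable: "(\<lambda>x. cmod (u x) * cmod (v x)) summable_on A"
    and infsum_abs_le_ell2_norm:
      "(\<Sum>\<^sub>\<infinity>x\<in>A. cmod (u x) * cmod (v x)) \<le> ell2_norm A u * ell2_norm A v"
proof -
  have *: "(\<Sum>x\<in>F. cmod (u x) * cmod (v x)) \<le> ell2_norm A u * ell2_norm A v"
    if "finite F" "F \<subseteq> A" for F
  proof -
    have "(\<Sum>x\<in>F. cmod (u x) * cmod (v x))
          \<le> L2_set (\<lambda>x. cmod (u x)) F * L2_set (\<lambda>x. cmod (v x)) F"
      using L2_set_mult_ineq[of "\<lambda>x. cmod (u x)" "\<lambda>x. cmod (v x)" F] by simp
    also have "\<dots> \<le> ell2_norm A u * ell2_norm A v"
      using assms that by (intro mult_mono L2_set_le_ell2_norm) auto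
    finally show ?thesis .
  qed
  show s: "(\<lambda>x. cmod (u x) * cmod (v x)) summable_on A"
    by (rule nonneg_bdd_above_summable_on)
       (auto intro!: bdd_aboveI2[where M = "ell2_norm A u * ell2_norm A v"] *)
  show "(\<Sum>\<^sub>\<infinity>x\<in>A. cmod (u x) * cmod (v x)) \<le> ell2_norm A u * ell2_norm A v"
    by (rule infsum_le_finite_sums[OF s *])
qed

lemma ell2_inner_summable:
  assumes "u \<in> ell2 A" "v \<in> ell2 A"
  shows "(\<lambda>x. u x * cnj (v x)) summable_on A"
  by (rule abs_summable_summable)
     (use ell2_inner_abs_summable[OF assms] in \<open>simp add: norm_mult\<close>)

lemma ell2_cauchy_schwarz:
  assumes "u \<in> ell2 A" "v \<in> ell2 A"
  shows "cmod (ell2_inner A u v) \<le> ell2_norm A u * ell2_norm A v"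
proof -
  have "cmod (ell2_inner A u v) \<le> (\<Sum>\<^sub>\<infinity>x\<in>A. cmod (u x * cnj (v x)))"
    unfolding ell2_inner_def
    by (rule norm_infsum_bound) (use ell2_inner_abs_summable[OF assms] in \<open>simp add: norm_mult\<close>)
  also have "\<dots> \<le> ell2_norm A u * ell2_norm A v"
    using infsum_abs_le_ell2_norm[OF assms] by (simp add: norm_mult)
  finally show ?thesis .
qed

lemma ell2_inner_self:
  assumes "u \<in> ell2 A"
  shows "ell2_inner A u u = complex_of_real ((ell2_norm A u)\<^sup>2)"
proof -
  have "((\<lambda>x. complex_of_real ((cmod (u x))\<^sup>2)) has_sum complex_of_real ((ell2_norm A u)\<^sup>2)) A"
    unfolding ell2_norm_power2
    by (intro has_sum_of_real has_sum_infsum) (use assms in \<open>simp add: ell2_def\<close>)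
  thus ?thesis
    unfolding ell2_inner_def complex_norm_square[symmetric] by (rule infsumI)
qed

lemma ell2_inner_commute: "ell2_inner A v u = cnj (ell2_inner A u v)"
  unfolding ell2_inner_def infsum_cnj[symmetric] by (simp add: mult.commute)

lemma ell2_inner_add_left:
  assumes "u \<in> ell2 A" "u' \<in> ell2 A" "v \<in> ell2 A"
  shows "ell2_inner A (\<lambda>x. u x + u' x) v = ell2_inner A u v + ell2_inner A u' v"
  unfolding ell2_inner_def
  by (subst infsum_add[symmetric]) (auto simp: ell2_inner_summable assms algebra_simps)

lemma ell2_inner_scale_left: "ell2_inner A (\<lambda>x. c * u x) v = c * ell2_inner A u v"
  unfolding ell2_inner_def by (simp add: mult.assoc infsum_cmult_right')

lemma ell2_inner_diff_left:
  assumes "u \<in> ell2 A" "u' \<in> ell2 A" "v \<in> ell2 A"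
  shows "ell2_inner A (\<lambda>x. u x - u' x) v = ell2_inner A u v - ell2_inner A u' v"
  using ell2_inner_add_left[OF assms(1) ell2_scale[OF assms(2), of "-1"] assms(3)]
  by (simp add: ell2_inner_scale_left[of A "-1" u' v, simplified])

lemma ell2_norm_diff_scale_power2:
  assumes u: "u \<in> ell2 A" and v: "v \<in> ell2 A"
  shows "(ell2_norm A (\<lambda>x. u x - complex_of_real t * v x))\<^sup>2
         = (ell2_norm A u)\<^sup>2 - 2 * t * Re (ell2_inner A v u) + t\<^sup>2 * (ell2_norm A v)\<^sup>2"
proof -
  let ?w = "\<lambda>x. u x - complex_of_real t * v x"
  have tv: "(\<lambda>x. complex_of_real t * v x) \<in> ell2 A" by (rule ell2_scale[OF v])
  have w: "?w \<in> ell2 A" by (rule ell2_diff[OF u tv])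
  have "ell2_inner A ?w ?w = ell2_inner A u ?w - of_real t * ell2_inner A v ?w"
    by (simp add: ell2_inner_diff_left[OF u tv w] ell2_inner_scale_left)
  also have "ell2_inner A u ?w = cnj (ell2_inner A u u) - of_real t * cnj (ell2_inner A v u)"
    unfolding ell2_inner_commute[of A u ?w]
    by (simp add: ell2_inner_diff_left[OF u tv u] ell2_inner_scale_left)
  also have "ell2_inner A v ?w = ell2_inner A v u - of_real t * cnj (ell2_inner A v v)"
    unfolding ell2_inner_commute[of A v ?w]
    by (simp add: ell2_inner_diff_left[OF u tv v] ell2_inner_scale_left ell2_inner_commute[of A v u])
  finally have "Re (ell2_inner A ?w ?w) = Re (cnj (ell2_inner A u u) - of_real t * cnj (ell2_inner A v u)
      - of_real t * (ell2_inner A v u - of_real t * cnj (ell2_inner A v v)))" by simp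
  thus ?thesis
    by (simp add: ell2_inner_self u v w power2_eq_square algebra_simps del: of_real_power of_real_mult)
qed

section \<open>Bounded operators on \<open>\<ell>\<^sup>2(A)\<close>\<close>

lemma bounded_operator_closed: "bounded_operator A T \<Longrightarrow> u \<in> ell2 A \<Longrightarrow> T u \<in> ell2 A"
  by (simp add: bounded_operator_def)

lemma bounded_operator_add:
  "bounded_operator A T \<Longrightarrow> u \<in> ell2 A \<Longrightarrow> v \<in> ell2 A
     \<Longrightarrow> T (\<lambda>x. u x + v x) = (\<lambda>x. T u x + T v x)"
  by (simp add: bounded_operator_def)

lemma bounded_operator_scale:
  "bounded_operator A T \<Longrightarrow> u \<in> ell2 A \<Longrightarrow> T (\<lambda>x. c * u x) = (\<lambda>x. c * T u x)"
  by (simp add: bounded_operator_def)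

lemma bounded_operator_zero: "bounded_operator A T \<Longrightarrow> T (\<lambda>x. 0) = (\<lambda>x. 0)"
  using bounded_operator_scale[of A T "\<lambda>x. 0" 0] by simp

lemma bounded_operator_diff:
  assumes "bounded_operator A T" "u \<in> ell2 A" "v \<in> ell2 A"
  shows "T (\<lambda>x. u x - v x) = (\<lambda>x. T u x - T v x)"
  using bounded_operator_add[OF assms(1,2) ell2_scale[OF assms(3), of "-1"]]
    bounded_operator_scale[OF assms(1,3), of "-1"] by simp

lemma bounded_operator_sum:
  assumes "bounded_operator A T" "\<And>i. i \<in> I \<Longrightarrow> u i \<in> ell2 A"
  shows "T (\<lambda>x. \<Sum>i\<in>I. u i x) = (\<lambda>x. \<Sum>i\<in>I. T (u i) x)"
  using assms(2)
  by (induction I rule: infinite_finite_induct)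
     (simp_all add: bounded_operator_zero[OF assms(1)] bounded_operator_add[OF assms(1)] ell2_sum)

lemma bounded_operator_bound:
  assumes "bounded_operator A T"
  obtains K where "K > 0" "\<And>u. u \<in> ell2 A \<Longrightarrow> ell2_norm A (T u) \<le> K * ell2_norm A u"
proof -
  obtain K where K: "\<And>u. u \<in> ell2 A \<Longrightarrow> ell2_norm A (T u) \<le> K * ell2_norm A u"
    using assms unfolding bounded_operator_def by blast
  show ?thesis
  proof (rule that[of "max K 1"])
    fix u assume "u \<in> ell2 A"
    then have "ell2_norm A (T u) \<le> K * ell2_norm A u" by (rule K)
    also have "\<dots> \<le> max K 1 * ell2_norm A u" by (intro mult_right_mono) auto
    finally show "ell2_norm A (T u) \<le> max K 1 * ell2_norm A u" .
  qed simp
qed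

lemma bounded_operator_compose:
  assumes S: "bounded_operator A S" and T: "bounded_operator A T"
  shows "bounded_operator A (\<lambda>u. S (T u))"
proof -
  obtain K where K: "K > 0" "\<And>u. u \<in> ell2 A \<Longrightarrow> ell2_norm A (S u) \<le> K * ell2_norm A u"
    using bounded_operator_bound[OF S] by blast
  obtain L where L: "L > 0" "\<And>u. u \<in> ell2 A \<Longrightarrow> ell2_norm A (T u) \<le> L * ell2_norm A u"
    using bounded_operator_bound[OF T] by blast
  have "ell2_norm A (S (T u)) \<le> (K * L) * ell2_norm A u" if "u \<in> ell2 A" for u
  proof -
    have "ell2_norm A (S (T u)) \<le> K * ell2_norm A (T u)"
      by (intro K bounded_operator_closed[OF T] that)
    also have "\<dots> \<le> K * (L * ell2_norm A u)"
      using K L that by (intro mult_left_mono) auto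
    finally show ?thesis by simp
  qed
  thus ?thesis
    unfolding bounded_operator_def
    by (auto simp: bounded_operator_closed[OF T] bounded_operator_closed[OF S]
        bounded_operator_add[OF T] bounded_operator_add[OF S]
        bounded_operator_scale[OF T] bounded_operator_scale[OF S])
qed

lemma bounded_operator_id: "bounded_operator A (\<lambda>u. u)"
  by (auto simp: bounded_operator_def intro!: exI[of _ 1])

lemma bounded_operator_funpow: "bounded_operator A T \<Longrightarrow> bounded_operator A (T ^^ n)"
  by (induction n) (simp_all add: bounded_operator_id id_def comp_def bounded_operator_compose)

lemma bounded_operator_lincomb:
  assumes S: "bounded_operator A S" and T: "bounded_operator A T"
  shows "bounded_operator A (\<lambda>u x. a * S u x + b * T u x)"
proof -
  obtain K where K: "K > 0" "\<And>u. u \<in> ell2 A \<Longrightarrow> ell2_norm A (S u) \<le> K * ell2_norm A u"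
    using bounded_operator_bound[OF S] by blast
  obtain L where L: "L > 0" "\<And>u. u \<in> ell2 A \<Longrightarrow> ell2_norm A (T u) \<le> L * ell2_norm A u"
    using bounded_operator_bound[OF T] by blast
  have "ell2_norm A (\<lambda>x. a * S u x + b * T u x) \<le> (cmod a * K + cmod b * L) * ell2_norm A u"
    if "u \<in> ell2 A" for u
  proof -
    have "ell2_norm A (\<lambda>x. a * S u x + b * T u x)
          \<le> ell2_norm A (\<lambda>x. a * S u x) + ell2_norm A (\<lambda>x. b * T u x)"
      by (intro ell2_norm_triangle ell2_scale bounded_operator_closed[OF S] bounded_operator_closed[OF T] that)
    also have "\<dots> \<le> cmod a * (K * ell2_norm A u) + cmod b * (L * ell2_norm A u)"
      unfolding ell2_norm_scale by (intro add_mono mult_left_mono K L that) auto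
    finally show ?thesis by (simp add: algebra_simps)
  qed
  then have "\<exists>K. \<forall>u\<in>ell2 A. ell2_norm A (\<lambda>x. a * S u x + b * T u x) \<le> K * ell2_norm A u"
    by blast
  thus ?thesis
    unfolding bounded_operator_def
    by (auto simp: bounded_operator_closed[OF T] bounded_operator_closed[OF S]
        bounded_operator_add[OF T] bounded_operator_add[OF S] algebra_simps
        bounded_operator_scale[OF T] bounded_operator_scale[OF S] intro!: ell2_add_mem ell2_scale)
qed

lemma bounded_operator_sum_ops:
  assumes "\<And>i. i \<in> I \<Longrightarrow> bounded_operator A (T i)"
  shows "bounded_operator A (\<lambda>u x. \<Sum>i\<in>I. T i u x)"
proof -
  have z: "bounded_operator A (\<lambda>u x. 0)"
    by (auto simp: bounded_operator_def intro!: exI[of _ 1])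
  show ?thesis
    using assms
  proof (induction I rule: infinite_finite_induct)
    case (insert i I)
    then show ?case
      using bounded_operator_lincomb[of A "T i" "\<lambda>u x. \<Sum>i\<in>I. T i u x" 1 1] by simp
  qed (simp_all add: z)
qed


section \<open>Coercive operators and resolvents\<close>

lemma ell2_norm_funpow_le:
  assumes T: "bounded_operator A T"
    and le: "\<And>u. u \<in> ell2 A \<Longrightarrow> ell2_norm A (T u) \<le> \<theta> * ell2_norm A u"
    and "\<theta> \<ge> 0" "f \<in> ell2 A"
  shows "ell2_norm A ((T ^^ n) f) \<le> \<theta> ^ n * ell2_norm A f"
proof (induction n)
  case (Suc n)
  have "ell2_norm A ((T ^^ Suc n) f) \<le> \<theta> * ell2_norm A ((T ^^ n) f)"
    using le bounded_operator_closed[OF bounded_operator_funpow[OF T]] assms by simp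
  also have "\<dots> \<le> \<theta> * (\<theta> ^ n * ell2_norm A f)"
    using Suc assms by (intro mult_left_mono)
  finally show ?case by simp
qed simp

text \<open>The solution is the Neumann series \<open>\<Sum>n. T\<^sup>n f\<close>.\<close>

lemma neumann_series_solution:
  assumes T: "bounded_operator A T"
    and le: "\<And>u. u \<in> ell2 A \<Longrightarrow> ell2_norm A (T u) \<le> \<theta> * ell2_norm A u"
    and \<theta>: "0 \<le> \<theta>" "\<theta> < 1" and f: "f \<in> ell2 A"
  shows "\<exists>v\<in>ell2 A. (\<lambda>x. v x - T v x) = f"
proof -
  define w where "w n = (T ^^ n) f" for n
  define v where "v = (\<lambda>x. \<Sum>n. w n x)"
  define s where "s N = (\<lambda>x. \<Sum>n<N. w n x)" for N
  have w: "w n \<in> ell2 A" for n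
    unfolding w_def by (intro bounded_operator_closed[OF bounded_operator_funpow[OF T]] f)
  have sm: "summable (\<lambda>n. ell2_norm A (w n))"
  proof (rule summable_comparison_test')
    show "summable (\<lambda>n. \<theta> ^ n * ell2_norm A f)"
      using \<theta> by (intro summable_mult2 summable_geometric) auto
    show "norm (ell2_norm A (w n)) \<le> \<theta> ^ n * ell2_norm A f" for n
      using ell2_norm_funpow_le[OF T le \<theta>(1) f, of n] by (simp add: w_def)
  qed
  have v: "v \<in> ell2 A" unfolding v_def by (rule ell2_suminf_mem[OF w sm])
  have s: "s N \<in> ell2 A" for N unfolding s_def by (rule ell2_sum) (rule w)
  \<comment> \<open>The partial sums satisfy \<open>T s\<^sub>N = s\<^sub>N\<^sub>+\<^sub>1 - f\<close>; let \<open>N\<close> tend to infinity pointwise.\<close>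
  have Ts: "T (s N) x = s (Suc N) x - f x" for N x
  proof -
    have "T (s N) x = (\<Sum>n<N. w (Suc n) x)"
      unfolding s_def bounded_operator_sum[OF T w] by (simp add: w_def)
    also have "\<dots> = s (Suc N) x - f x"
      unfolding s_def by (subst sum.lessThan_Suc_shift) (simp add: w_def)
    finally show ?thesis .
  qed
  have tail: "(\<lambda>N. ell2_norm A (\<lambda>x. v x - s N x)) \<longlonglongrightarrow> 0"
    unfolding v_def s_def by (rule ell2_norm_tail[OF w sm])
  have "v x - T v x = f x" for x
  proof -
    have "(\<lambda>N. s N x) \<longlonglongrightarrow> v x"
      unfolding s_def v_def
      by (intro summable_LIMSEQ summable_comparison_test'[OF sm]) (simp add: cmod_le_ell2_norm w)
    hence "(\<lambda>N. s (Suc N) x - f x) \<longlonglongrightarrow> v x - f x"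
      by (intro tendsto_intros LIMSEQ_Suc)
    moreover have "(\<lambda>N. T v x - T (s N) x) \<longlonglongrightarrow> 0"
    proof (rule Lim_null_comparison)
      show "\<forall>\<^sub>F N in sequentially. cmod (T v x - T (s N) x) \<le> \<theta> * ell2_norm A (\<lambda>x. v x - s N x)"
      proof (intro always_eventually allI)
        fix N
        have "cmod (T v x - T (s N) x) = cmod (T (\<lambda>x. v x - s N x) x)"
          by (simp add: bounded_operator_diff[OF T v s])
        also have "\<dots> \<le> ell2_norm A (T (\<lambda>x. v x - s N x))"
          by (intro cmod_le_ell2_norm bounded_operator_closed[OF T] ell2_diff v s)
        also have "\<dots> \<le> \<theta> * ell2_norm A (\<lambda>x. v x - s N x)"
          by (intro le ell2_diff v s)
        finally show "cmod (T v x - T (s N) x) \<le> \<theta> * ell2_norm A (\<lambda>x. v x - s N x)" .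
      qed
      show "(\<lambda>N. \<theta> * ell2_norm A (\<lambda>x. v x - s N x)) \<longlonglongrightarrow> 0"
        using tendsto_mult_left[OF tail, of \<theta>] by simp
    qed
    hence "(\<lambda>N. T v x - (T v x - T (s N) x)) \<longlonglongrightarrow> T v x - 0"
      by (intro tendsto_intros)
    hence "(\<lambda>N. T (s N) x) \<longlonglongrightarrow> T v x" by simp
    ultimately have "T v x = v x - f x"
      unfolding Ts by (rule LIMSEQ_unique[symmetric])
    thus ?thesis by simp
  qed
  thus ?thesis using v by blast
qed

text \<open>The Lax--Milgram theorem: for small \<open>\<tau> > 0\<close> the operator \<open>u \<mapsto> u - \<tau> B u\<close> is a contraction,
  because \<open>\<parallel>u - \<tau> B u\<parallel>\<^sup>2 = \<parallel>u\<parallel>\<^sup>2 - 2 \<tau> Re \<langle>B u, u\<rangle> + \<tau>\<^sup>2 \<parallel>B u\<parallel>\<^sup>2\<close>.\<close>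

lemma coercive_operator_surj:
  assumes B: "bounded_operator A B" and c: "c > 0"
    and coer: "\<And>u. u \<in> ell2 A \<Longrightarrow> c * (ell2_norm A u)\<^sup>2 \<le> Re (ell2_inner A (B u) u)"
    and f: "f \<in> ell2 A"
  shows "\<exists>u\<in>ell2 A. B u = f"
proof -
  obtain K0 where K0: "K0 > 0" "\<And>u. u \<in> ell2 A \<Longrightarrow> ell2_norm A (B u) \<le> K0 * ell2_norm A u"
    using bounded_operator_bound[OF B] by blast
  \<comment> \<open>Enlarging the bound to at least \<open>c\<close> keeps \<open>q = 1 - (c / K)\<^sup>2\<close> below nonnegative.\<close>
  define K where "K = max K0 c"
  have K: "K > 0" "c \<le> K" using c by (auto simp: K_def)
  have KB: "ell2_norm A (B u) \<le> K * ell2_norm A u" if "u \<in> ell2 A" for u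
    using K0(2)[OF that] mult_right_mono[of K0 K "ell2_norm A u"] by (simp add: K_def)
  define t where "t = c / K\<^sup>2"
  have t: "t > 0" using c K by (simp add: t_def)
  define T where "T u = (\<lambda>x. u x - complex_of_real t * B u x)" for u
  have T: "bounded_operator A T"
    using bounded_operator_lincomb[OF bounded_operator_id B, of 1 "- complex_of_real t"]
    by (simp add: T_def[abs_def])
  define q where "q = 1 - (c / K)\<^sup>2"
  have "0 < c / K" "c / K \<le> 1" using K c by simp_all
  hence "(c / K)\<^sup>2 \<le> 1" "(c / K)\<^sup>2 > 0"
    by (simp_all only: power_le_one less_imp_le zero_less_power)
  hence q: "0 \<le> q" "q < 1" by (auto simp: q_def)
  have le: "ell2_norm A (T u) \<le> sqrt q * ell2_norm A u" if u: "u \<in> ell2 A" for u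
  proof (rule power2_le_imp_le)
    have "(ell2_norm A (T u))\<^sup>2
          = (ell2_norm A u)\<^sup>2 - 2 * t * Re (ell2_inner A (B u) u) + t\<^sup>2 * (ell2_norm A (B u))\<^sup>2"
      unfolding T_def by (rule ell2_norm_diff_scale_power2[OF u bounded_operator_closed[OF B u]])
    also have "\<dots> \<le> (ell2_norm A u)\<^sup>2 - 2 * t * (c * (ell2_norm A u)\<^sup>2)
        + t\<^sup>2 * (K * ell2_norm A u)\<^sup>2"
      using t KB[OF u] coer[OF u] by (intro add_mono diff_mono mult_left_mono power_mono) auto
    also have "\<dots> = q * (ell2_norm A u)\<^sup>2"
    proof -
      have "t * c = (c / K)\<^sup>2" "t\<^sup>2 * K\<^sup>2 = (c / K)\<^sup>2"
        using K by (simp_all add: t_def power_divide power2_eq_square)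
      hence q_eq: "q = 1 - 2 * (t * c) + t\<^sup>2 * K\<^sup>2" by (simp add: q_def)
      show ?thesis unfolding q_eq by (simp add: algebra_simps power_mult_distrib)
    qed
    finally show "(ell2_norm A (T u))\<^sup>2 \<le> (sqrt q * ell2_norm A u)\<^sup>2"
      using q by (simp add: power_mult_distrib)
  qed (use q in simp)
  obtain v where v: "v \<in> ell2 A" "(\<lambda>x. v x - T v x) = f"
    using neumann_series_solution[OF T le _ _ f] q by auto
  have "B (\<lambda>x. complex_of_real t * v x) = f"
    unfolding bounded_operator_scale[OF B v(1)] v(2)[symmetric] by (simp add: T_def)
  thus ?thesis using ell2_scale[OF v(1)] by blast
qed

lemma resolvent_setI:
  assumes T: "bounded_operator A T" and c: "c > 0"
    and low: "\<And>u. u \<in> ell2 A \<Longrightarrow> c * ell2_norm A u \<le> ell2_norm A (\<lambda>x. \<zeta> * u x - T u x)"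
    and surj: "\<And>f. f \<in> ell2 A \<Longrightarrow> \<exists>u\<in>ell2 A. (\<lambda>x. \<zeta> * u x - T u x) = f"
  shows "\<zeta> \<in> resolvent_set A T"
proof -
  define B where "B u = (\<lambda>x. \<zeta> * u x - T u x)" for u
  have B: "bounded_operator A B"
    using bounded_operator_lincomb[OF bounded_operator_id T, of \<zeta> "-1"] by (simp add: B_def[abs_def])
  have low': "c * ell2_norm A u \<le> ell2_norm A (B u)" if "u \<in> ell2 A" for u
    unfolding B_def by (rule low[OF that])
  have inj: "u = v" if "u \<in> ell2 A" "v \<in> ell2 A" "B u = B v" for u v
  proof -
    have d: "(\<lambda>x. u x - v x) \<in> ell2 A" by (intro ell2_diff that)
    have "B (\<lambda>x. u x - v x) = (\<lambda>x. 0)"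
      by (simp only: bounded_operator_diff[OF B that(1,2)] that(3) diff_self)
    hence "c * ell2_norm A (\<lambda>x. u x - v x) \<le> 0"
      using low'[OF d] by (simp only: ell2_norm_zero)
    hence "ell2_norm A (\<lambda>x. u x - v x) \<le> 0"
      using c by (simp add: mult_le_0_iff)
    hence "ell2_norm A (\<lambda>x. u x - v x) = 0"
      by (intro antisym) auto
    hence "(\<lambda>x. u x - v x) = (\<lambda>x. 0)"
      using ell2_norm_eq_0_iff[OF d] by blast
    thus ?thesis by (simp add: fun_eq_iff)
  qed
  define S where "S f = (SOME u. u \<in> ell2 A \<and> B u = f)" for f
  have S: "S f \<in> ell2 A" "B (S f) = f" if "f \<in> ell2 A" for f
  proof -
    have "\<exists>u. u \<in> ell2 A \<and> B u = f" using surj[OF that] unfolding B_def by blast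
    from someI_ex[OF this] show "S f \<in> ell2 A" "B (S f) = f" unfolding S_def by blast+
  qed
  have SB: "S (B u) = u" if "u \<in> ell2 A" for u
    by (rule inj) (simp_all add: S that bounded_operator_closed[OF B])
  have "bounded_operator A S"
    unfolding bounded_operator_def
  proof (intro conjI ballI allI exI[of _ "1 / c"])
    fix u assume u: "u \<in> ell2 A"
    show "S u \<in> ell2 A" by (rule S[OF u])
    show "ell2_norm A (S u) \<le> 1 / c * ell2_norm A u"
      using low'[OF S(1)[OF u]] c by (simp add: S(2)[OF u] field_simps)
    show "S (\<lambda>x. a * u x) = (\<lambda>x. a * S u x)" for a
      by (rule inj) (simp_all add: S u ell2_scale bounded_operator_scale[OF B])
    show "S (\<lambda>x. u x + v x) = (\<lambda>x. S u x + S v x)" if v: "v \<in> ell2 A" for v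
      by (rule inj) (simp_all add: S u v ell2_add_mem bounded_operator_add[OF B])
  qed
  thus ?thesis
    unfolding resolvent_set_def mem_Collect_eq
    by (intro exI[of _ S] conjI ballI) (simp_all add: SB S flip: B_def)
qed

text \<open>If \<open>(\<zeta> - T) Q = Q (\<zeta> - T)\<close> is coercive, then \<open>\<zeta> - T\<close> is onto and bounded below. With a
  constant \<open>Q\<close> this bounds the spectrum by the numerical range; with \<open>Q\<close> a polynomial in \<open>T\<close> it is
  an instance of spectral mapping.\<close>

lemma resolvent_setI_coercive:
  assumes T: "bounded_operator A T" and Q: "bounded_operator A Q" and c: "c > 0"
    and comm: "\<And>u. u \<in> ell2 A \<Longrightarrow> Q (\<lambda>x. \<zeta> * u x - T u x) = (\<lambda>x. \<zeta> * Q u x - T (Q u) x)"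
    and coer: "\<And>u. u \<in> ell2 A \<Longrightarrow>
      c * (ell2_norm A u)\<^sup>2 \<le> Re (ell2_inner A (\<lambda>x. \<zeta> * Q u x - T (Q u) x) u)"
  shows "\<zeta> \<in> resolvent_set A T"
proof -
  define B where "B u = (\<lambda>x. \<zeta> * Q u x - T (Q u) x)" for u
  have B: "bounded_operator A B"
    using bounded_operator_lincomb[OF Q bounded_operator_compose[OF T Q], of \<zeta> "-1"]
    by (simp add: B_def[abs_def])
  obtain L where L: "L > 0" "\<And>u. u \<in> ell2 A \<Longrightarrow> ell2_norm A (Q u) \<le> L * ell2_norm A u"
    using bounded_operator_bound[OF Q] by blast
  show ?thesis
  proof (rule resolvent_setI[OF T])
    show "c / L > 0" using c L by simp
    fix u assume u: "u \<in> ell2 A"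
    have mem: "(\<lambda>x. \<zeta> * u x - T u x) \<in> ell2 A"
      by (intro ell2_diff ell2_scale u bounded_operator_closed[OF T])
    have "c * (ell2_norm A u)\<^sup>2 \<le> cmod (ell2_inner A (B u) u)"
      using coer[OF u] complex_Re_le_cmod[of "ell2_inner A (B u) u"] by (simp add: B_def)
    also have "\<dots> \<le> ell2_norm A (B u) * ell2_norm A u"
      by (intro ell2_cauchy_schwarz bounded_operator_closed[OF B] u)
    finally have "c * ell2_norm A u * ell2_norm A u \<le> ell2_norm A (B u) * ell2_norm A u"
      by (simp add: power2_eq_square mult.assoc)
    hence "c * ell2_norm A u \<le> ell2_norm A (B u)"
      using ell2_norm_nonneg[of A u] ell2_norm_nonneg[of A "B u"]
      by (cases "ell2_norm A u = 0") (simp_all add: mult_le_cancel_right)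
    also have "B u = Q (\<lambda>x. \<zeta> * u x - T u x)"
      using comm[OF u] by (simp add: B_def)
    also have "ell2_norm A \<dots> \<le> L * ell2_norm A (\<lambda>x. \<zeta> * u x - T u x)"
      by (rule L(2)[OF mem])
    finally show "c / L * ell2_norm A u \<le> ell2_norm A (\<lambda>x. \<zeta> * u x - T u x)"
      using L by (simp add: field_simps)
  next
    fix f assume "f \<in> ell2 A"
    then obtain u where "u \<in> ell2 A" "B u = f"
      using coercive_operator_surj[OF B c] coer by (auto simp: B_def)
    thus "\<exists>u\<in>ell2 A. (\<lambda>x. \<zeta> * u x - T u x) = f"
      by (intro bexI[of _ "Q u"] bounded_operator_closed[OF Q]) (auto simp: B_def)
  qed
qed


section \<open>Symmetric stochastic kernels\<close>

text \<open>The integral operator of a real kernel \<open>p\<close> on \<open>A\<close>. Values off \<open>A\<close> are set to \<open>0\<close>, so that it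
  maps into the functions representing \<open>\<ell>\<^sup>2(A)\<close>.\<close>

definition kernel_operator :: "'a set \<Rightarrow> ('a \<Rightarrow> 'a \<Rightarrow> real) \<Rightarrow> ('a \<Rightarrow> complex) \<Rightarrow> 'a \<Rightarrow> complex" where
  "kernel_operator A p u x = (if x \<in> A then \<Sum>\<^sub>\<infinity>y\<in>A. complex_of_real (p x y) * u y else 0)"

text \<open>A Markov kernel on \<open>A\<close>: nonnegative entries and unit row sums.\<close>

definition stochastic_kernel :: "'a set \<Rightarrow> ('a \<Rightarrow> 'a \<Rightarrow> real) \<Rightarrow> bool" where
  "stochastic_kernel A p \<longleftrightarrow> (\<forall>x\<in>A. (\<forall>y\<in>A. p x y \<ge> 0) \<and> (p x has_sum 1) A)"

lemma stochastic_kernel_nonneg: "stochastic_kernel A p \<Longrightarrow> x \<in> A \<Longrightarrow> y \<in> A \<Longrightarrow> 0 \<le> p x y"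
  and stochastic_kernel_has_sum: "stochastic_kernel A p \<Longrightarrow> x \<in> A \<Longrightarrow> (p x has_sum 1) A"
  by (simp_all add: stochastic_kernel_def)

lemma stochastic_kernel_abs_summable:
  assumes p: "stochastic_kernel A p" and x: "x \<in> A" and u: "\<And>y. cmod (u y) \<le> C"
  shows "(\<lambda>y. norm (complex_of_real (p x y) * u y)) summable_on A"
proof (rule Infinite_Sum.abs_summable_on_comparison_test')
  show "(\<lambda>y. p x y * C) summable_on A"
    by (intro summable_on_cmult_left has_sum_imp_summable[OF stochastic_kernel_has_sum[OF p x]])
  show "norm (complex_of_real (p x y) * u y) \<le> p x y * C" if "y \<in> A" for y
    using stochastic_kernel_nonneg[OF p x that] u[of y] by (simp add: norm_mult mult_left_mono)
qed

lemma stochastic_kernel_summable: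
  assumes "stochastic_kernel A p" "x \<in> A" "u \<in> ell2 A"
  shows "(\<lambda>y. complex_of_real (p x y) * u y) summable_on A"
  by (rule abs_summable_summable, rule stochastic_kernel_abs_summable[OF assms(1,2)])
     (rule cmod_le_ell2_norm[OF assms(3)])

text \<open>Chapman--Kolmogorov for operators; the interchange of sums is justified because \<open>u\<close> is
  bounded.\<close>

lemma kernel_operator_compose:
  assumes p: "stochastic_kernel A p" and q: "stochastic_kernel A q" and u: "u \<in> ell2 A"
    and r: "\<And>x z. x \<in> A \<Longrightarrow> z \<in> A \<Longrightarrow> r x z = (\<Sum>\<^sub>\<infinity>y\<in>A. p x y * q y z)"
  shows "kernel_operator A r u = kernel_operator A p (kernel_operator A q u)"
proof
  fix x
  define C where "C = ell2_norm A u"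
  show "kernel_operator A r u x = kernel_operator A p (kernel_operator A q u) x"
  proof (cases "x \<in> A")
    case x: True
    let ?f = "\<lambda>(y, z). complex_of_real (p x y) * (complex_of_real (q y z) * u z)"
    let ?g = "\<lambda>(y, z). p x y * q y z"
    have sg: "?g summable_on A \<times> A"
    proof (rule summable_on_SigmaI)
      show "((\<lambda>z. ?g (y, z)) has_sum p x y * 1) A" if "y \<in> A" for y
        using has_sum_cmult_right[OF stochastic_kernel_has_sum[OF q that], of "p x y"] by simp
      show "(\<lambda>y. p x y * 1) summable_on A"
        using has_sum_imp_summable[OF stochastic_kernel_has_sum[OF p x]] by simp
    qed (use stochastic_kernel_nonneg[OF p x] stochastic_kernel_nonneg[OF q] in auto)
    have "(\<lambda>yz. norm (?f yz)) summable_on A \<times> A"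
    proof (rule Infinite_Sum.abs_summable_on_comparison_test')
      show "(\<lambda>yz. ?g yz * C) summable_on A \<times> A"
        by (intro summable_on_cmult_left sg)
      show "norm (?f yz) \<le> ?g yz * C" if "yz \<in> A \<times> A" for yz
        using that stochastic_kernel_nonneg[OF p x] stochastic_kernel_nonneg[OF q]
          cmod_le_ell2_norm[OF u]
        by (auto simp: norm_mult C_def mult.assoc intro!: mult_left_mono)
    qed
    hence sf: "?f summable_on A \<times> A" by (rule abs_summable_summable)
    have "kernel_operator A p (kernel_operator A q u) x
          = (\<Sum>\<^sub>\<infinity>y\<in>A. complex_of_real (p x y) * (\<Sum>\<^sub>\<infinity>z\<in>A. complex_of_real (q y z) * u z))"
      using x by (auto simp: kernel_operator_def intro!: infsum_cong)
    also have "\<dots> = (\<Sum>\<^sub>\<infinity>y\<in>A. \<Sum>\<^sub>\<infinity>z\<in>A. complex_of_real (p x y) * (complex_of_real (q y z) * u z))"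
      by (simp add: infsum_cmult_right')
    also have "\<dots> = (\<Sum>\<^sub>\<infinity>z\<in>A. \<Sum>\<^sub>\<infinity>y\<in>A. complex_of_real (p x y) * (complex_of_real (q y z) * u z))"
      by (rule infsum_swap_banach[OF sf])
    also have "\<dots> = (\<Sum>\<^sub>\<infinity>z\<in>A. complex_of_real (r x z) * u z)"
    proof (rule infsum_cong)
      fix z assume z: "z \<in> A"
      have "(\<lambda>(z, y). p x y * q y z) summable_on A \<times> A"
        using sg by (subst summable_on_swap) (simp add: case_prod_unfold)
      hence s: "(\<lambda>y. p x y * q y z) summable_on A"
        using summable_on_SigmaD1[of "\<lambda>z y. p x y * q y z" A "\<lambda>_. A" z] z by simp
      have "((\<lambda>y. complex_of_real (p x y * q y z)) has_sum complex_of_real (r x z)) A"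
        unfolding r[OF x z] by (intro has_sum_of_real has_sum_infsum s)
      from has_sum_cmult_left[OF this, of "u z"]
      show "(\<Sum>\<^sub>\<infinity>y\<in>A. complex_of_real (p x y) * (complex_of_real (q y z) * u z))
            = complex_of_real (r x z) * u z"
        by (simp add: infsumI mult.assoc)
    qed
    finally show ?thesis using x by (simp add: kernel_operator_def)
  qed (simp add: kernel_operator_def)
qed

lemma kernel_operator_linear:
  assumes p: "stochastic_kernel A p" and u: "u \<in> ell2 A"
  shows kernel_operator_add: "v \<in> ell2 A \<Longrightarrow> kernel_operator A p (\<lambda>x. u x + v x)
      = (\<lambda>x. kernel_operator A p u x + kernel_operator A p v x)"
    and kernel_operator_scale: "kernel_operator A p (\<lambda>x. c * u x) = (\<lambda>x. c * kernel_operator A p u x)"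
proof -
  show "kernel_operator A p (\<lambda>x. u x + v x)
      = (\<lambda>x. kernel_operator A p u x + kernel_operator A p v x)" if v: "v \<in> ell2 A"
    using stochastic_kernel_summable[OF p _ u] stochastic_kernel_summable[OF p _ v]
    by (auto simp: kernel_operator_def fun_eq_iff distrib_left infsum_add)
  show "kernel_operator A p (\<lambda>x. c * u x) = (\<lambda>x. c * kernel_operator A p u x)"
    by (auto simp: kernel_operator_def fun_eq_iff mult.left_commute[of _ c] infsum_cmult_right')
qed

text \<open>For a symmetric stochastic kernel the column sums are \<open>1\<close> as well. By the Cauchy--Schwarz
  inequality for the probability weights \<open>p x\<close> (Schur's test), the operator is a contraction of
  \<open>\<ell>\<^sup>2(A)\<close>; the double sums involved converge absolutely, which also gives self-adjointness.\<close>

context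
  fixes A :: "'a set" and p :: "'a \<Rightarrow> 'a \<Rightarrow> real"
  assumes stoch: "stochastic_kernel A p"
    and sym: "\<And>x y. x \<in> A \<Longrightarrow> y \<in> A \<Longrightarrow> p x y = p y x"
begin

lemma symmetric_kernel_summable:
  assumes u: "u \<in> ell2 A"
  shows "((\<lambda>(y, x). p x y * (cmod (u y))\<^sup>2) has_sum (ell2_norm A u)\<^sup>2) (A \<times> A)"
proof (rule has_sum_SigmaI)
  show *: "((\<lambda>x. case (y, x) of (y, x) \<Rightarrow> p x y * (cmod (u y))\<^sup>2) has_sum 1 * (cmod (u y))\<^sup>2) A"
    if y: "y \<in> A" for y
  proof -
    have "((\<lambda>x. p y x * (cmod (u y))\<^sup>2) has_sum 1 * (cmod (u y))\<^sup>2) A"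
      by (intro has_sum_cmult_left stochastic_kernel_has_sum[OF stoch y])
    thus ?thesis using sym[OF y] by (subst has_sum_cong) auto
  qed
  show **: "((\<lambda>y. 1 * (cmod (u y))\<^sup>2) has_sum (ell2_norm A u)\<^sup>2) A"
    unfolding ell2_norm_power2 using u by (auto simp: ell2_def intro!: has_sum_infsum)
  show "(\<lambda>(y, x). p x y * (cmod (u y))\<^sup>2) summable_on A \<times> A"
    by (rule summable_on_SigmaI[OF * has_sum_imp_summable[OF **]])
       (auto intro!: mult_nonneg_nonneg stochastic_kernel_nonneg[OF stoch])
qed

lemma cmod_kernel_operator_power2_le:
  assumes u: "u \<in> ell2 A" and x: "x \<in> A" and s: "(\<lambda>y. p x y * (cmod (u y))\<^sup>2) summable_on A"
  shows "(cmod (kernel_operator A p u x))\<^sup>2 \<le> (\<Sum>\<^sub>\<infinity>y\<in>A. p x y * (cmod (u y))\<^sup>2)"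
proof -
  define a where "a y = (if y \<in> A then complex_of_real (sqrt (p x y)) else 0)" for y
  define b where "b y = (if y \<in> A then complex_of_real (sqrt (p x y)) * u y else 0)" for y
  have p: "0 \<le> p x y" if "y \<in> A" for y by (rule stochastic_kernel_nonneg[OF stoch x that])
  have a2: "(cmod (a y))\<^sup>2 = p x y" and b2: "(cmod (b y))\<^sup>2 = p x y * (cmod (u y))\<^sup>2"
    if "y \<in> A" for y
    using p[OF that] that by (simp_all add: a_def b_def norm_mult power_mult_distrib)
  have ab: "cmod (a y) * cmod (b y) = norm (complex_of_real (p x y) * u y)" if "y \<in> A" for y
    using p[OF that] that by (simp add: a_def b_def norm_mult flip: mult.assoc)
  have "(\<lambda>y. (cmod (a y))\<^sup>2) summable_on A"
    using has_sum_imp_summable[OF stochastic_kernel_has_sum[OF stoch x]]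
    by (subst summable_on_cong[OF a2])
  hence a: "a \<in> ell2 A" by (simp add: ell2_def a_def)
  have "(\<lambda>y. (cmod (b y))\<^sup>2) summable_on A"
    using s by (subst summable_on_cong[OF b2])
  hence b: "b \<in> ell2 A" by (simp add: ell2_def b_def)
  have na: "(ell2_norm A a)\<^sup>2 = 1"
    unfolding ell2_norm_power2
    using infsumI[OF stochastic_kernel_has_sum[OF stoch x]] by (subst infsum_cong[OF a2])
  have nb: "(ell2_norm A b)\<^sup>2 = (\<Sum>\<^sub>\<infinity>y\<in>A. p x y * (cmod (u y))\<^sup>2)"
    unfolding ell2_norm_power2 by (rule infsum_cong[OF b2])
  have "cmod (kernel_operator A p u x) \<le> (\<Sum>\<^sub>\<infinity>y\<in>A. norm (complex_of_real (p x y) * u y))"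
    using x norm_infsum_bound[OF stochastic_kernel_abs_summable[OF stoch x cmod_le_ell2_norm[OF u]]]
    by (simp add: kernel_operator_def)
  also have "\<dots> = (\<Sum>\<^sub>\<infinity>y\<in>A. cmod (a y) * cmod (b y))"
    by (rule infsum_cong[OF ab[symmetric]])
  also have "\<dots> \<le> ell2_norm A a * ell2_norm A b"
    by (rule infsum_abs_le_ell2_norm[OF a b])
  finally have "(cmod (kernel_operator A p u x))\<^sup>2 \<le> (ell2_norm A a * ell2_norm A b)\<^sup>2"
    by (intro power_mono) auto
  thus ?thesis by (simp add: power_mult_distrib na nb)
qed

lemma symmetric_kernel_contraction:
  assumes u: "u \<in> ell2 A"
  shows symmetric_kernel_mem: "kernel_operator A p u \<in> ell2 A"
    and symmetric_kernel_norm_le: "ell2_norm A (kernel_operator A p u) \<le> ell2_norm A u"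
proof -
  define S where "S x = (\<Sum>\<^sub>\<infinity>y\<in>A. p x y * (cmod (u y))\<^sup>2)" for x
  have h: "((\<lambda>(x, y). p x y * (cmod (u y))\<^sup>2) has_sum (ell2_norm A u)\<^sup>2) (A \<times> A)"
    using symmetric_kernel_summable[OF u] by (subst has_sum_swap) (simp add: case_prod_unfold)
  have s: "(\<lambda>y. p x y * (cmod (u y))\<^sup>2) summable_on A" if "x \<in> A" for x
    using summable_on_SigmaD1[of "\<lambda>x y. p x y * (cmod (u y))\<^sup>2" A "\<lambda>_. A" x]
      has_sum_imp_summable[OF h] that by simp
  have S: "(S has_sum (ell2_norm A u)\<^sup>2) A"
    by (rule has_sum_SigmaD[OF h]) (use s in \<open>simp add: S_def\<close>)
  have *: "L2_set (\<lambda>x. cmod (kernel_operator A p u x)) F \<le> ell2_norm A u"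
    if F: "finite F" "F \<subseteq> A" for F
  proof -
    have "(\<Sum>x\<in>F. (cmod (kernel_operator A p u x))\<^sup>2) \<le> (\<Sum>x\<in>F. S x)"
      unfolding S_def using F by (intro sum_mono cmod_kernel_operator_power2_le u s) auto
    also have "\<dots> \<le> (ell2_norm A u)\<^sup>2"
      using F by (intro finite_sum_le_has_sum[OF S])
        (auto simp: S_def intro!: infsum_nonneg mult_nonneg_nonneg stochastic_kernel_nonneg[OF stoch])
    finally show ?thesis unfolding L2_set_def by (simp add: real_le_lsqrt sum_nonneg)
  qed
  have z: "kernel_operator A p u x = 0" if "x \<notin> A" for x
    using that by (simp add: kernel_operator_def)
  show "kernel_operator A p u \<in> ell2 A" by (rule ell2_of_finite_bound(1)[OF z *])
  show "ell2_norm A (kernel_operator A p u) \<le> ell2_norm A u"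
    by (rule ell2_of_finite_bound(2)[OF z *])
qed

lemma bounded_operator_symmetric_kernel: "bounded_operator A (kernel_operator A p)"
  unfolding bounded_operator_def
  by (intro conjI ballI allI exI[of _ 1])
     (simp_all add: symmetric_kernel_contraction kernel_operator_linear[OF stoch])

lemma symmetric_kernel_self_adjoint:
  assumes u: "u \<in> ell2 A" and v: "v \<in> ell2 A"
  shows "ell2_inner A (kernel_operator A p u) v = ell2_inner A u (kernel_operator A p v)"
proof -
  let ?f = "\<lambda>(x, y). complex_of_real (p x y) * u y * cnj (v x)"
  let ?g = "\<lambda>(x, y). p x y * (cmod (u y))\<^sup>2 + p x y * (cmod (v x))\<^sup>2"
  have 1: "(\<lambda>(x, y). p x y * (cmod (u y))\<^sup>2) summable_on A \<times> A"
    using has_sum_imp_summable[OF symmetric_kernel_summable[OF u]]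
    by (subst summable_on_swap) (simp add: case_prod_unfold)
  have 2: "(\<lambda>(x, y). p x y * (cmod (v x))\<^sup>2) summable_on A \<times> A"
    using has_sum_imp_summable[OF symmetric_kernel_summable[OF v]]
    by (subst summable_on_cong[where g = "\<lambda>(y, x). p x y * (cmod (v y))\<^sup>2"]) (auto simp: sym)
  have g: "?g summable_on A \<times> A"
    using summable_on_add[OF 1 2] by (simp add: case_prod_unfold)
  have "(\<lambda>xy. norm (?f xy)) summable_on A \<times> A"
  proof (rule Infinite_Sum.abs_summable_on_comparison_test'[OF g])
    fix xy assume "xy \<in> A \<times> A"
    then obtain x y where xy: "xy = (x, y)" "x \<in> A" "y \<in> A" by auto
    have "cmod (u y) * cmod (v x) \<le> (cmod (u y))\<^sup>2 + (cmod (v x))\<^sup>2"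
      using sum_squares_bound[of "cmod (u y)" "cmod (v x)"]
        mult_nonneg_nonneg[OF norm_ge_zero norm_ge_zero, of "u y" "v x"] by linarith
    hence "p x y * (cmod (u y) * cmod (v x)) \<le> p x y * ((cmod (u y))\<^sup>2 + (cmod (v x))\<^sup>2)"
      using stochastic_kernel_nonneg[OF stoch xy(2,3)] by (rule mult_left_mono)
    thus "norm (?f xy) \<le> ?g xy"
      using stochastic_kernel_nonneg[OF stoch xy(2,3)]
      by (simp add: xy norm_mult distrib_left mult.assoc)
  qed
  hence f: "?f summable_on A \<times> A" by (rule abs_summable_summable)
  have "ell2_inner A (kernel_operator A p u) v
        = (\<Sum>\<^sub>\<infinity>x\<in>A. (\<Sum>\<^sub>\<infinity>y\<in>A. complex_of_real (p x y) * u y) * cnj (v x))"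
    unfolding ell2_inner_def by (rule infsum_cong) (simp add: kernel_operator_def)
  also have "\<dots> = (\<Sum>\<^sub>\<infinity>x\<in>A. \<Sum>\<^sub>\<infinity>y\<in>A. complex_of_real (p x y) * u y * cnj (v x))"
    by (simp add: infsum_cmult_left')
  also have "\<dots> = (\<Sum>\<^sub>\<infinity>y\<in>A. \<Sum>\<^sub>\<infinity>x\<in>A. complex_of_real (p x y) * u y * cnj (v x))"
    by (rule infsum_swap_banach[OF f])
  also have "\<dots> = (\<Sum>\<^sub>\<infinity>y\<in>A. u y * cnj (kernel_operator A p v y))"
  proof (rule infsum_cong)
    fix y assume y: "y \<in> A"
    have "(\<Sum>\<^sub>\<infinity>x\<in>A. complex_of_real (p x y) * u y * cnj (v x))
          = (\<Sum>\<^sub>\<infinity>x\<in>A. u y * cnj (complex_of_real (p y x) * v x))"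
      using sym[OF y] by (intro infsum_cong) simp
    also have "\<dots> = u y * cnj (kernel_operator A p v y)"
      using y by (simp add: infsum_cmult_right' kernel_operator_def del: complex_cnj_mult)
    finally show "(\<Sum>\<^sub>\<infinity>x\<in>A. complex_of_real (p x y) * u y * cnj (v x))
          = u y * cnj (kernel_operator A p v y)" .
  qed
  finally show ?thesis by (simp add: ell2_inner_def)
qed

end

text \<open>Since \<open>q - \<delta> I\<close> has nonnegative entries, its quadratic form at \<open>u\<close> is dominated by its
  quadratic form at \<open>\<bar>u\<bar>\<close>, which is at most \<open>(C - \<delta>) \<parallel>u\<parallel>\<^sup>2\<close>. So a diagonal \<open>\<delta> > 0\<close> keeps the quadratic
  form of \<open>q\<close> away from \<open>- C \<parallel>u\<parallel>\<^sup>2\<close>.\<close>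

lemma positive_diagonal_form_bound:
  assumes q: "stochastic_kernel A q" and diag: "\<And>x. x \<in> A \<Longrightarrow> q x x = \<delta>"
    and C: "\<And>u. u \<in> ell2 A \<Longrightarrow> kernel_operator A q u \<in> ell2 A"
      "\<And>u. u \<in> ell2 A \<Longrightarrow> ell2_norm A (kernel_operator A q u) \<le> C * ell2_norm A u"
    and u: "u \<in> ell2 A"
  shows "cmod (ell2_inner A (kernel_operator A q u) u - of_real (\<delta> * (ell2_norm A u)\<^sup>2))
         \<le> (C - \<delta>) * (ell2_norm A u)\<^sup>2"
proof -
  define a where "a x = complex_of_real (cmod (u x))" for x
  define K where "K = kernel_operator A q"
  have a: "a \<in> ell2 A" and na: "ell2_norm A a = ell2_norm A u"
    using u by (simp_all add: ell2_def ell2_norm_def a_def)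
  have pw: "cmod (K u x - of_real \<delta> * u x) \<le> cmod (K a x) - \<delta> * cmod (u x)" if x: "x \<in> A" for x
  proof -
    define q' where "q' y = q x y - (if y = x then \<delta> else 0)" for y
    have q': "q' y \<ge> 0" if "y \<in> A" for y
      using stochastic_kernel_nonneg[OF q x that] diag[OF x] by (simp add: q'_def)
    have split: "((\<lambda>y. complex_of_real (q' y) * w y) has_sum (K w x - of_real \<delta> * w x)) A"
      if w: "w \<in> ell2 A" for w
    proof -
      have 1: "((\<lambda>y. complex_of_real (q x y) * w y) has_sum K w x) A"
        using has_sum_infsum[OF stochastic_kernel_summable[OF q x w]] x
        by (simp add: K_def kernel_operator_def)
      have 2: "((\<lambda>y. if y = x then - (of_real \<delta> * w x) else 0) has_sum - (of_real \<delta> * w x)) A"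
        by (rule has_sum_finite_neutralI[of "{x}"]) (use x in auto)
      show ?thesis
        using has_sum_add[OF 1 2]
        by (subst has_sum_cong[where g = "\<lambda>y. complex_of_real (q x y) * w y
              + (if y = x then - (of_real \<delta> * w x) else 0)"])
           (auto simp: q'_def algebra_simps)
    qed
    have n: "((\<lambda>y. norm (complex_of_real (q' y) * u y)) has_sum Re (K a x - of_real \<delta> * a x)) A"
      using has_sum_Re[OF split[OF a]]
      by (subst has_sum_cong[where g = "\<lambda>y. Re (complex_of_real (q' y) * a y)"])
         (use q' in \<open>auto simp: a_def norm_mult\<close>)
    have "cmod (K u x - of_real \<delta> * u x) \<le> Re (K a x - of_real \<delta> * a x)"
      using norm_infsum_bound[OF has_sum_imp_summable[OF n]]
      by (simp only: infsumI[OF n] infsumI[OF split[OF u]])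
    also have "\<dots> \<le> cmod (K a x) - \<delta> * cmod (u x)"
      using complex_Re_le_cmod[of "K a x"] by (simp add: a_def)
    finally show ?thesis .
  qed
  have Ku: "K u \<in> ell2 A" and Ka: "K a \<in> ell2 A"
    using C(1) u a by (simp_all add: K_def)
  have du: "(\<lambda>x. of_real \<delta> * u x) \<in> ell2 A" by (rule ell2_scale[OF u])
  define w where "w = (\<lambda>x. K u x - of_real \<delta> * u x)"
  have w: "w \<in> ell2 A" unfolding w_def by (rule ell2_diff[OF Ku du])
  have "ell2_inner A w u = ell2_inner A (K u) u - of_real (\<delta> * (ell2_norm A u)\<^sup>2)"
    unfolding w_def ell2_inner_diff_left[OF Ku du u] ell2_inner_scale_left ell2_inner_self[OF u]
    by simp
  hence "cmod (ell2_inner A (K u) u - of_real (\<delta> * (ell2_norm A u)\<^sup>2)) = cmod (ell2_inner A w u)"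
    by simp
  also have "\<dots> \<le> (\<Sum>\<^sub>\<infinity>x\<in>A. norm (w x * cnj (u x)))"
    unfolding ell2_inner_def
    by (rule norm_infsum_bound) (use ell2_inner_abs_summable[OF w u] in \<open>simp add: norm_mult\<close>)
  also have "\<dots> = (\<Sum>\<^sub>\<infinity>x\<in>A. cmod (w x) * cmod (u x))"
    by (simp add: norm_mult)
  also have "\<dots> \<le> (\<Sum>\<^sub>\<infinity>x\<in>A. cmod (K a x) * cmod (u x) + - \<delta> * (cmod (u x))\<^sup>2)"
  proof (rule infsum_mono)
    show "(\<lambda>x. cmod (K a x) * cmod (u x) + - \<delta> * (cmod (u x))\<^sup>2) summable_on A"
      by (intro summable_on_add summable_on_cmult_right ell2_inner_abs_summable[OF Ka u])
         (use u in \<open>simp add: ell2_def\<close>)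
    show "cmod (w x) * cmod (u x) \<le> cmod (K a x) * cmod (u x) + - \<delta> * (cmod (u x))\<^sup>2"
      if "x \<in> A" for x
      using mult_right_mono[OF pw[OF that], of "cmod (u x)"]
      by (simp add: w_def algebra_simps power2_eq_square)
  qed (rule ell2_inner_abs_summable[OF w u])
  also have "\<dots> = (\<Sum>\<^sub>\<infinity>x\<in>A. cmod (K a x) * cmod (u x)) + - \<delta> * (ell2_norm A u)\<^sup>2"
    unfolding ell2_norm_power2 infsum_cmult_right'[symmetric]
    by (intro infsum_add summable_on_cmult_right ell2_inner_abs_summable[OF Ka u])
       (use u in \<open>simp add: ell2_def\<close>)
  also have "\<dots> \<le> ell2_norm A (K a) * ell2_norm A u + - \<delta> * (ell2_norm A u)\<^sup>2"
    by (intro add_right_mono infsum_abs_le_ell2_norm Ka u)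
  also have "\<dots> \<le> (C * ell2_norm A u) * ell2_norm A u + - \<delta> * (ell2_norm A u)\<^sup>2"
    using C(2)[OF a] by (intro add_right_mono mult_right_mono) (simp_all add: K_def na)
  finally show ?thesis by (simp add: K_def algebra_simps power2_eq_square)
qed


section \<open>The Markov operator of a symmetric random walk\<close>

lemma pmf_has_sum_1:
  assumes "set_pmf p \<subseteq> A"
  shows "(pmf p has_sum 1) A"
proof -
  have a: "Infinite_Set_Sum.abs_summable_on (pmf p) A" by (rule pmf_abs_summable)
  have "infsum (pmf p) A = 1"
    using infsetsum_infsum[OF a] infsetsum_pmf_eq_1[OF assms] by simp
  moreover have "pmf p summable_on A"
    using a unfolding abs_summable_equivalent[symmetric] by (rule abs_summable_summable)
  ultimately show ?thesis by (simp add: has_sum_iff)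
qed

lemma expectation_eq_infsum:
  fixes f :: "'a \<Rightarrow> real"
  assumes "set_pmf p \<subseteq> A" and f: "\<And>x. \<bar>f x\<bar> \<le> C"
  shows "measure_pmf.expectation p f = (\<Sum>\<^sub>\<infinity>x\<in>A. pmf p x * f x)"
proof -
  have "(\<lambda>x. norm (pmf p x * f x)) summable_on UNIV"
  proof (rule Infinite_Sum.abs_summable_on_comparison_test')
    show "(\<lambda>x. pmf p x * C) summable_on UNIV"
      by (intro summable_on_cmult_left has_sum_imp_summable[OF pmf_has_sum_1]) simp
    show "norm (pmf p x * f x) \<le> pmf p x * C" for x
      using f[of x] by (simp add: abs_mult mult_left_mono)
  qed
  hence "measure_pmf.expectation p f = (\<Sum>\<^sub>\<infinity>x. pmf p x * f x)"
    unfolding pmf_expectation_eq_infsetsum abs_summable_equivalent by (rule infsetsum_infsum)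
  also have "\<dots> = (\<Sum>\<^sub>\<infinity>x\<in>A. pmf p x * f x)"
    using assms(1) by (intro infsum_cong_neutral) (auto simp: set_pmf_eq)
  finally show ?thesis .
qed

lemma set_pmf_walk_law:
  assumes "group G" "set_pmf \<mu> \<subseteq> carrier G" "x \<in> carrier G"
  shows "set_pmf (walk_law G \<mu> n x) \<subseteq> carrier G"
proof -
  interpret group G by fact
  show ?thesis
    using assms(3)
  proof (induction n arbitrary: x)
    case (Suc n)
    then show ?case using assms(2) by (auto simp: walk_law_Suc)
  qed (simp add: walk_law_0)
qed

lemma walk_prob_stochastic:
  assumes "group G" "set_pmf \<mu> \<subseteq> carrier G"
  shows "stochastic_kernel (carrier G) (walk_prob G \<mu> n)"
proof -
  have "(walk_prob G \<mu> n x has_sum 1) (carrier G)" if "x \<in> carrier G" for x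
    using pmf_has_sum_1[OF set_pmf_walk_law[OF assms that, of n]]
    by (simp add: walk_prob_def[abs_def])
  thus ?thesis by (simp add: stochastic_kernel_def walk_prob_nonneg)
qed

lemma walk_prob_chapman_kolmogorov:
  assumes "group G" "set_pmf \<mu> \<subseteq> carrier G" "x \<in> carrier G"
  shows "walk_prob G \<mu> (m + n) x z
         = (\<Sum>\<^sub>\<infinity>y\<in>carrier G. walk_prob G \<mu> m x y * walk_prob G \<mu> n y z)"
proof -
  have "walk_prob G \<mu> (m + n) x z
        = measure_pmf.expectation (walk_law G \<mu> m x) (\<lambda>y. walk_prob G \<mu> n y z)"
    by (simp add: walk_prob_def walk_law_add pmf_bind)
  also have "\<dots> = (\<Sum>\<^sub>\<infinity>y\<in>carrier G. pmf (walk_law G \<mu> m x) y * walk_prob G \<mu> n y z)"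
    by (rule expectation_eq_infsum[OF set_pmf_walk_law[OF assms], where C = 1])
       (simp add: walk_prob_nonneg walk_prob_le_1)
  finally show ?thesis by (simp add: walk_prob_def)
qed

lemma walk_law_translate:
  assumes "group G" "set_pmf \<mu> \<subseteq> carrier G" "x \<in> carrier G" "a \<in> carrier G"
  shows "walk_law G \<mu> n (a \<otimes>\<^bsub>G\<^esub> x) = map_pmf (\<lambda>y. a \<otimes>\<^bsub>G\<^esub> y) (walk_law G \<mu> n x)"
proof -
  interpret group G by fact
  show ?thesis
    using assms(3)
  proof (induction n arbitrary: x)
    case (Suc n)
    show ?case
      unfolding walk_law_Suc map_bind_pmf
    proof (rule bind_pmf_cong[OF refl])
      fix g assume "g \<in> set_pmf \<mu>"
      hence g: "g \<in> carrier G" using assms(2) by auto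
      show "walk_law G \<mu> n (a \<otimes>\<^bsub>G\<^esub> x \<otimes>\<^bsub>G\<^esub> g)
            = map_pmf (\<lambda>y. a \<otimes>\<^bsub>G\<^esub> y) (walk_law G \<mu> n (x \<otimes>\<^bsub>G\<^esub> g))"
        using Suc.IH[of "x \<otimes>\<^bsub>G\<^esub> g"] Suc.prems g assms(4) by (simp add: m_assoc)
    qed
  qed (simp add: walk_law_0)
qed

text \<open>Return probabilities do not depend on the starting point, by left invariance of the walk.\<close>

lemma walk_prob_diagonal:
  assumes "group G" "set_pmf \<mu> \<subseteq> carrier G" "x \<in> carrier G"
  shows "walk_prob G \<mu> n x x = walk_prob G \<mu> n \<one>\<^bsub>G\<^esub> \<one>\<^bsub>G\<^esub>"
proof -
  interpret group G by fact
  let ?p = "walk_law G \<mu> n \<one>\<^bsub>G\<^esub>"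
  have sub: "set_pmf ?p \<subseteq> carrier G" by (rule set_pmf_walk_law[OF assms(1,2) one_closed])
  have law: "walk_law G \<mu> n x = map_pmf (\<lambda>y. x \<otimes>\<^bsub>G\<^esub> y) ?p"
    using walk_law_translate[OF assms(1,2) one_closed assms(3), of n] assms(3) by simp
  have "walk_prob G \<mu> n x x = measure (measure_pmf ?p) ({y. x \<otimes>\<^bsub>G\<^esub> y = x} \<inter> set_pmf ?p)"
    by (simp add: walk_prob_def law pmf_map vimage_def measure_Int_set_pmf)
  also have "{y. x \<otimes>\<^bsub>G\<^esub> y = x} \<inter> set_pmf ?p = {\<one>\<^bsub>G\<^esub>} \<inter> set_pmf ?p"
    using sub assms(3) by auto
  also have "measure (measure_pmf ?p) \<dots> = walk_prob G \<mu> n \<one>\<^bsub>G\<^esub> \<one>\<^bsub>G\<^esub>"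
    by (simp add: measure_Int_set_pmf walk_prob_def measure_pmf_single)
  finally show ?thesis .
qed

lemma step_prob_symmetric:
  assumes "group G" "set_pmf \<mu> \<subseteq> carrier G" "symmetric_walk G \<mu>"
    and "x \<in> carrier G" "y \<in> carrier G"
  shows "step_prob G \<mu> x y = step_prob G \<mu> y x"
proof -
  interpret group G by fact
  define g where "g = inv\<^bsub>G\<^esub> x \<otimes>\<^bsub>G\<^esub> y"
  have g: "g \<in> carrier G" "inv\<^bsub>G\<^esub> y \<otimes>\<^bsub>G\<^esub> x = inv\<^bsub>G\<^esub> g"
    using assms(4,5) by (simp_all add: g_def inv_mult_group)
  have "pmf \<mu> (inv\<^bsub>G\<^esub> g) = pmf (map_pmf (\<lambda>g. inv\<^bsub>G\<^esub> g) \<mu>) (inv\<^bsub>G\<^esub> g)"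
    using assms(3) by (simp add: symmetric_walk_def)
  also have "\<dots> = measure (measure_pmf \<mu>) ({h. inv\<^bsub>G\<^esub> h = inv\<^bsub>G\<^esub> g} \<inter> set_pmf \<mu>)"
    by (simp add: pmf_map vimage_def measure_Int_set_pmf)
  also have "{h. inv\<^bsub>G\<^esub> h = inv\<^bsub>G\<^esub> g} \<inter> set_pmf \<mu> = {g} \<inter> set_pmf \<mu>"
  proof -
    have "h = g" if "inv\<^bsub>G\<^esub> h = inv\<^bsub>G\<^esub> g" "h \<in> set_pmf \<mu>" for h
      using inv_inv[of h] inv_inv[of g] that g(1) assms(2) by auto
    thus ?thesis by auto
  qed
  also have "measure (measure_pmf \<mu>) \<dots> = pmf \<mu> g"
    by (simp add: measure_Int_set_pmf measure_pmf_single)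
  finally show ?thesis by (simp add: step_prob_def g(2) flip: g_def)
qed

lemma markov_operator_eq_kernel:
  assumes "group G" "set_pmf \<mu> \<subseteq> carrier G"
  shows "markov_operator G \<mu> = kernel_operator (carrier G) (walk_prob G \<mu> 1)"
  using walk_prob_one[OF assms]
  by (auto simp: fun_eq_iff markov_operator_def kernel_operator_def intro!: infsum_cong)

lemma walk_prob_1_symmetric:
  assumes "group G" "set_pmf \<mu> \<subseteq> carrier G" "symmetric_walk G \<mu>"
    and "x \<in> carrier G" "y \<in> carrier G"
  shows "walk_prob G \<mu> 1 x y = walk_prob G \<mu> 1 y x"
  using step_prob_symmetric[OF assms] walk_prob_one[OF assms(1,2)] assms(4,5) by simp

lemma bounded_operator_markov:
  assumes "group G" "set_pmf \<mu> \<subseteq> carrier G" "symmetric_walk G \<mu>"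
  shows "bounded_operator (carrier G) (markov_operator G \<mu>)"
  unfolding markov_operator_eq_kernel[OF assms(1,2)]
  by (intro bounded_operator_symmetric_kernel walk_prob_stochastic walk_prob_1_symmetric assms)

lemma markov_operator_self_adjoint:
  assumes "group G" "set_pmf \<mu> \<subseteq> carrier G" "symmetric_walk G \<mu>"
    and "u \<in> ell2 (carrier G)" "v \<in> ell2 (carrier G)"
  shows "ell2_inner (carrier G) (markov_operator G \<mu> u) v
         = ell2_inner (carrier G) u (markov_operator G \<mu> v)"
  unfolding markov_operator_eq_kernel[OF assms(1,2)]
  by (intro symmetric_kernel_self_adjoint walk_prob_stochastic walk_prob_1_symmetric assms)

lemma markov_operator_funpow:
  assumes "group G" "set_pmf \<mu> \<subseteq> carrier G" "u \<in> ell2 (carrier G)"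
  shows "(markov_operator G \<mu> ^^ n) u = kernel_operator (carrier G) (walk_prob G \<mu> n) u"
proof (induction n)
  case 0
  show ?case
  proof
    fix x
    have "((\<lambda>y. complex_of_real (walk_prob G \<mu> 0 x y) * u y) has_sum u x) (carrier G)"
      if "x \<in> carrier G"
      by (rule has_sum_finite_neutralI[of "{x}"])
         (use that in \<open>auto simp: walk_prob_def walk_law_0\<close>)
    thus "(markov_operator G \<mu> ^^ 0) u x = kernel_operator (carrier G) (walk_prob G \<mu> 0) u x"
      using ell2_outside[OF assms(3), of x] by (auto simp: kernel_operator_def infsumI)
  qed
next
  case (Suc n)
  have "(markov_operator G \<mu> ^^ Suc n) u
        = kernel_operator (carrier G) (walk_prob G \<mu> 1)
            (kernel_operator (carrier G) (walk_prob G \<mu> n) u)"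
    using Suc by (simp add: markov_operator_eq_kernel[OF assms(1,2)])
  also have "\<dots> = kernel_operator (carrier G) (walk_prob G \<mu> (1 + n)) u"
    by (rule kernel_operator_compose[symmetric])
       (intro walk_prob_stochastic walk_prob_chapman_kolmogorov assms)+
  finally show ?case by simp
qed

section \<open>The norm of the Markov operator is at most \<open>1/R\<close>\<close>

lemma self_adjoint_funpow:
  assumes T: "bounded_operator A T"
    and sa: "\<And>u v. u \<in> ell2 A \<Longrightarrow> v \<in> ell2 A \<Longrightarrow> ell2_inner A (T u) v = ell2_inner A u (T v)"
    and u: "u \<in> ell2 A" and v: "v \<in> ell2 A"
  shows "ell2_inner A ((T ^^ n) u) v = ell2_inner A u ((T ^^ n) v)"
  using u
proof (induction n arbitrary: u)
  case (Suc n)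
  have "ell2_inner A ((T ^^ Suc n) u) v = ell2_inner A ((T ^^ n) (T u)) v"
    by (simp add: funpow_swap1)
  also have "\<dots> = ell2_inner A (T u) ((T ^^ n) v)"
    by (intro Suc.IH bounded_operator_closed[OF T] Suc.prems)
  also have "\<dots> = ell2_inner A u (T ((T ^^ n) v))"
    by (intro sa Suc.prems bounded_operator_closed[OF bounded_operator_funpow[OF T]] v)
  finally show ?case by simp
qed simp

text \<open>The norms \<open>\<parallel>T\<^sup>n f\<parallel>\<close> of the iterates of a self-adjoint operator are log-convex in \<open>n\<close>, so they
  grow at least at the rate of the first step.\<close>

lemma self_adjoint_funpow_norm_ge:
  assumes T: "bounded_operator A T"
    and sa: "\<And>u v. u \<in> ell2 A \<Longrightarrow> v \<in> ell2 A \<Longrightarrow> ell2_inner A (T u) v = ell2_inner A u (T v)"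
    and f: "f \<in> ell2 A" and r: "r \<ge> 0" "r * ell2_norm A f \<le> ell2_norm A (T f)"
  shows "r ^ n * ell2_norm A f \<le> ell2_norm A ((T ^^ n) f)"
proof -
  define b where "b n = ell2_norm A ((T ^^ n) f)" for n
  have mem: "(T ^^ n) f \<in> ell2 A" for n
    by (intro bounded_operator_closed[OF bounded_operator_funpow[OF T]] f)
  have b0: "b n \<ge> 0" for n by (simp add: b_def)
  have convex: "(b (Suc n))\<^sup>2 \<le> b (Suc (Suc n)) * b n" for n
  proof -
    have "complex_of_real ((b (Suc n))\<^sup>2) = ell2_inner A ((T ^^ Suc n) f) (T ((T ^^ n) f))"
      using ell2_inner_self[OF mem[of "Suc n"]] by (simp add: b_def)
    also have "\<dots> = ell2_inner A ((T ^^ Suc (Suc n)) f) ((T ^^ n) f)"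
      using sa[OF mem[of "Suc n"] mem[of n]] by simp
    finally have "cmod (complex_of_real ((b (Suc n))\<^sup>2))
        = cmod (ell2_inner A ((T ^^ Suc (Suc n)) f) ((T ^^ n) f))"
      by (rule arg_cong)
    hence "(b (Suc n))\<^sup>2 = cmod (ell2_inner A ((T ^^ Suc (Suc n)) f) ((T ^^ n) f))"
      by (simp only: norm_of_real abs_of_nonneg[OF zero_le_power2])
    thus ?thesis using ell2_cauchy_schwarz[OF mem[of "Suc (Suc n)"] mem[of n]]
      by (simp only: b_def)
  qed
  have step: "r * b n \<le> b (Suc n)" for n
  proof (induction n)
    case 0
    show ?case using r by (simp add: b_def)
  next
    case (Suc n)
    show ?case
    proof (cases "b (Suc n) = 0")
      case False
      with b0[of "Suc n"] have pos: "b (Suc n) > 0" by simp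
      have bn: "b n > 0"
        using convex[of n] pos b0[of n] by (cases "b n = 0") auto
      have "(r * b (Suc n)) * b n \<le> b (Suc n) * b (Suc n)"
        using mult_left_mono[OF Suc, of "b (Suc n)"] pos by (simp add: algebra_simps)
      also have "\<dots> \<le> b (Suc (Suc n)) * b n"
        using convex[of n] by (simp add: power2_eq_square)
      finally show ?thesis using bn by simp
    qed (simp add: b0)
  qed
  have "r ^ n * b 0 \<le> b n"
  proof (induction n)
    case (Suc n)
    have "r ^ Suc n * b 0 \<le> r * b n" using mult_left_mono[OF Suc r(1)] by simp
    also have "\<dots> \<le> b (Suc n)" by (rule step)
    finally show ?case .
  qed simp
  thus ?thesis by (simp add: b_def)
qed

lemma walk_prob_decay:
  assumes "group G" "irreducible_walk G \<mu>" "x \<in> carrier G" "y \<in> carrier G"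
    and z: "0 \<le> z" "z < green_radius G \<mu>"
  shows "(\<lambda>n. walk_prob G \<mu> n x y * z ^ n) \<longlonglongrightarrow> 0"
proof -
  have "summable (\<lambda>n. complex_of_real (walk_prob G \<mu> n x y) * complex_of_real z ^ n)"
    by (rule summable_in_conv_radius) (use z in \<open>simp add: conv_radius_green(1)[OF assms(1-4)]\<close>)
  hence "(\<lambda>n. complex_of_real (walk_prob G \<mu> n x y) * complex_of_real z ^ n) \<longlonglongrightarrow> 0"
    by (rule summable_LIMSEQ_zero)
  from tendsto_norm_zero[OF this] show ?thesis
    using z by (simp add: norm_mult norm_power walk_prob_nonneg)
qed

lemma kernel_operator_finite_support:
  assumes F: "finite F" "F \<subseteq> A" and f: "\<And>y. y \<notin> F \<Longrightarrow> f y = 0" and x: "x \<in> A"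
  shows "kernel_operator A p f x = (\<Sum>y\<in>F. complex_of_real (p x y) * f y)"
proof -
  have "(\<Sum>\<^sub>\<infinity>y\<in>A. complex_of_real (p x y) * f y) = (\<Sum>\<^sub>\<infinity>y\<in>F. complex_of_real (p x y) * f y)"
    using F f by (intro infsum_cong_neutral) auto
  thus ?thesis using F x by (simp add: kernel_operator_def)
qed

text \<open>For finitely supported \<open>f\<close>, \<open>\<parallel>T\<^sup>n f\<parallel>\<^sup>2 = \<langle>T\<^sup>2\<^sup>n f, f\<rangle>\<close> is a finite combination of the numbers
  \<open>p\<^sup>2\<^sup>n(x,y)\<close>, so it is \<open>o(z\<^sup>-\<^sup>2\<^sup>n)\<close> whenever \<open>0 < z < R\<close>. If \<open>\<parallel>T f\<parallel> / \<parallel>f\<parallel> = r > 1/R\<close>, log-convexity gives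
  \<open>\<parallel>T\<^sup>n f\<parallel> \<ge> r\<^sup>n \<parallel>f\<parallel>\<close>, a contradiction at \<open>z = 1/r\<close>.\<close>

lemma markov_operator_norm_le_finite_support:
  assumes G: "group G" "set_pmf \<mu> \<subseteq> carrier G" "symmetric_walk G \<mu>" "irreducible_walk G \<mu>"
    and F: "finite F" "F \<subseteq> carrier G" and f: "\<And>y. y \<notin> F \<Longrightarrow> f y = 0"
  shows "ell2_norm (carrier G) (markov_operator G \<mu> f)
         \<le> inverse (green_radius G \<mu>) * ell2_norm (carrier G) f"
proof (rule ccontr)
  let ?A = "carrier G" and ?T = "markov_operator G \<mu>" and ?R = "green_radius G \<mu>"
  assume "\<not> ?thesis"
  hence gt: "inverse ?R * ell2_norm ?A f < ell2_norm ?A (?T f)" by simp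
  have R: "?R \<ge> 1"
    using conv_radius_green(2)[OF G(1,4) group.is_monoid[OF G(1), THEN monoid.one_closed]
        group.is_monoid[OF G(1), THEN monoid.one_closed]] .
  have T: "bounded_operator ?A ?T" by (rule bounded_operator_markov[OF G(1-3)])
  note sa = markov_operator_self_adjoint[OF G(1-3)]
  have f2: "f \<in> ell2 ?A"
  proof -
    have "{x \<in> ?A. (cmod (f x))\<^sup>2 \<noteq> 0} \<subseteq> F" using f by auto
    hence "(\<lambda>x. (cmod (f x))\<^sup>2) summable_on ?A"
      by (intro finite_nonzero_values_imp_summable_on) (rule finite_subset[OF _ F(1)])
    moreover have "f x = 0" if "x \<notin> ?A" for x using f F that by blast
    ultimately show ?thesis by (simp add: ell2_def)
  qed
  have mem: "(?T ^^ n) f \<in> ell2 ?A" for n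
    by (intro bounded_operator_closed[OF bounded_operator_funpow[OF T]] f2)
  have pos: "ell2_norm ?A f > 0"
  proof (rule ccontr)
    assume "\<not> ?thesis"
    hence n0: "ell2_norm ?A f = 0" using ell2_norm_nonneg[of ?A f] by linarith
    hence "f = (\<lambda>x. 0)" using ell2_norm_eq_0_iff[OF f2] by blast
    hence "?T f = (\<lambda>x. 0)" using bounded_operator_zero[OF T] by simp
    thus False using gt n0 by simp
  qed
  define r where "r = ell2_norm ?A (?T f) / ell2_norm ?A f"
  have r: "inverse ?R < r" "r > 0"
  proof -
    show "inverse ?R < r" using gt pos by (simp add: r_def field_simps)
    moreover have "0 < inverse ?R" using R by simp
    ultimately show "r > 0" by linarith
  qed
  have grow: "r ^ n * ell2_norm ?A f \<le> ell2_norm ?A ((?T ^^ n) f)" for n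
    by (rule self_adjoint_funpow_norm_ge[OF T sa f2]) (use r pos in \<open>auto simp: r_def\<close>)
  define z where "z = inverse r"
  have z: "0 < z" "z < ?R" "r * z = 1"
    using r R less_imp_inverse_less[OF r(1)] by (auto simp: z_def)
  define s where "s n = (\<Sum>x\<in>F. \<Sum>y\<in>F. (walk_prob G \<mu> n x y * z ^ n) * (cmod (f y) * cmod (f x)))" for n
  have "s \<longlonglongrightarrow> (\<Sum>x\<in>F. \<Sum>y\<in>F. 0 * (cmod (f y) * cmod (f x)))"
    unfolding s_def
    by (intro tendsto_sum tendsto_mult tendsto_const walk_prob_decay[OF G(1,4)])
       (use F z in auto)
  hence "s \<longlonglongrightarrow> 0" by simp
  moreover have "strict_mono (\<lambda>n::nat. n + n)" by (auto simp: strict_mono_def)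
  ultimately have lim: "(\<lambda>n. s (n + n)) \<longlonglongrightarrow> 0"
    using LIMSEQ_subseq_LIMSEQ[of s 0 "\<lambda>n. n + n"] by (simp add: o_def)
  have "(ell2_norm ?A f)\<^sup>2 \<le> s (n + n)" for n
  proof -
    have "complex_of_real ((ell2_norm ?A ((?T ^^ n) f))\<^sup>2) = ell2_inner ?A ((?T ^^ n) f) ((?T ^^ n) f)"
      by (rule ell2_inner_self[OF mem, symmetric])
    also have "\<dots> = ell2_inner ?A ((?T ^^ (n + n)) f) f"
      using self_adjoint_funpow[OF T sa mem[of n] f2, of n] by (simp add: funpow_add)
    also have "\<dots> = (\<Sum>\<^sub>\<infinity>x\<in>F. (?T ^^ (n + n)) f x * cnj (f x))"
      unfolding ell2_inner_def using F f by (intro infsum_cong_neutral) auto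
    also have "\<dots> = (\<Sum>x\<in>F. \<Sum>y\<in>F. complex_of_real (walk_prob G \<mu> (n + n) x y) * f y * cnj (f x))"
      using F by (simp add: markov_operator_funpow[OF G(1,2) f2] sum_distrib_right
          kernel_operator_finite_support[OF F f] subset_iff)
    finally have "cmod (complex_of_real ((ell2_norm ?A ((?T ^^ n) f))\<^sup>2))
        = cmod (\<Sum>x\<in>F. \<Sum>y\<in>F. complex_of_real (walk_prob G \<mu> (n + n) x y) * f y * cnj (f x))"
      by (rule arg_cong)
    hence "(ell2_norm ?A ((?T ^^ n) f))\<^sup>2
        = cmod (\<Sum>x\<in>F. \<Sum>y\<in>F. complex_of_real (walk_prob G \<mu> (n + n) x y) * f y * cnj (f x))"
      by (simp only: norm_of_real abs_of_nonneg[OF zero_le_power2])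
    also have "\<dots> \<le> (\<Sum>x\<in>F. \<Sum>y\<in>F. walk_prob G \<mu> (n + n) x y * (cmod (f y) * cmod (f x)))"
      by (intro order_trans[OF norm_sum] sum_mono) 
         (simp add: norm_mult walk_prob_nonneg mult.assoc)
    finally have "(ell2_norm ?A ((?T ^^ n) f))\<^sup>2 * z ^ (n + n)
        \<le> (\<Sum>x\<in>F. \<Sum>y\<in>F. walk_prob G \<mu> (n + n) x y * (cmod (f y) * cmod (f x))) * z ^ (n + n)"
      by (rule mult_right_mono) (use z in simp)
    also have "\<dots> = s (n + n)"
      unfolding s_def sum_distrib_right by (intro sum.cong refl) (simp only: mult_ac)
    finally have *: "(ell2_norm ?A ((?T ^^ n) f))\<^sup>2 * z ^ (n + n) \<le> s (n + n)" .
    have "(ell2_norm ?A f)\<^sup>2 = (r ^ n * ell2_norm ?A f)\<^sup>2 * z ^ (n + n)"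
    proof -
      have "(r ^ n)\<^sup>2 * z ^ (n + n) = ((r * z) ^ n)\<^sup>2"
        by (simp add: power_add power2_eq_square power_mult_distrib mult_ac)
      thus ?thesis using z by (simp add: power_mult_distrib mult_ac)
    qed
    also have "\<dots> \<le> (ell2_norm ?A ((?T ^^ n) f))\<^sup>2 * z ^ (n + n)"
      using z r pos by (intro mult_right_mono power_mono grow) auto
    finally show ?thesis using * by linarith
  qed
  hence "(ell2_norm ?A f)\<^sup>2 \<le> 0"
    by (intro LIMSEQ_le_const[OF lim]) auto
  thus False using pos by simp
qed

theorem markov_operator_norm_le:
  assumes G: "group G" "set_pmf \<mu> \<subseteq> carrier G" "symmetric_walk G \<mu>" "irreducible_walk G \<mu>"
    and u: "u \<in> ell2 (carrier G)"
  shows "ell2_norm (carrier G) (markov_operator G \<mu> u)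
         \<le> inverse (green_radius G \<mu>) * ell2_norm (carrier G) u"
proof (rule ell2_of_finite_bound(2))
  let ?A = "carrier G" and ?p = "walk_prob G \<mu> 1" and ?R = "green_radius G \<mu>"
  note T_eq = markov_operator_eq_kernel[OF G(1,2)]
  have R: "?R \<ge> 1"
    using conv_radius_green(2)[OF G(1,4) group.is_monoid[OF G(1), THEN monoid.one_closed]
        group.is_monoid[OF G(1), THEN monoid.one_closed]] .
  show "markov_operator G \<mu> u x = 0" if "x \<notin> ?A" for x
    using that by (simp add: markov_operator_def)
  fix H assume H: "finite H" "H \<subseteq> ?A"
  \<comment> \<open>On the finite set \<open>H\<close>, \<open>T u\<close> is the limit of \<open>T f\<close> over the finite truncations \<open>f\<close> of \<open>u\<close>.\<close>
  show "L2_set (\<lambda>x. cmod (markov_operator G \<mu> u x)) H \<le> inverse ?R * ell2_norm ?A u"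
  proof (rule tendsto_upperbound)
    have "((\<lambda>F. \<Sum>y\<in>F. complex_of_real (?p x y) * u y) \<longlongrightarrow> markov_operator G \<mu> u x)
            (finite_subsets_at_top ?A)" if "x \<in> H" for x
      using has_sum_infsum[OF stochastic_kernel_summable[OF walk_prob_stochastic[OF G(1,2)] _ u], of x 1]
        that H by (auto simp: has_sum_def T_eq kernel_operator_def)
    thus "((\<lambda>F. L2_set (\<lambda>x. cmod (\<Sum>y\<in>F. complex_of_real (?p x y) * u y)) H) \<longlongrightarrow>
          L2_set (\<lambda>x. cmod (markov_operator G \<mu> u x)) H) (finite_subsets_at_top ?A)"
      unfolding L2_set_def by (intro tendsto_intros) auto
    have "L2_set (\<lambda>x. cmod (\<Sum>y\<in>F. complex_of_real (?p x y) * u y)) H \<le> inverse ?R * ell2_norm ?A u"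
      if F: "finite F" "F \<subseteq> ?A" for F
    proof -
      define f where "f y = (if y \<in> F then u y else 0)" for y
      have f: "f \<in> ell2 ?A" "ell2_norm ?A f \<le> ell2_norm ?A u"
        by (rule ell2_norm_mono[OF u]; simp add: f_def)+
      have eq: "markov_operator G \<mu> f x = (\<Sum>y\<in>F. complex_of_real (?p x y) * u y)" if "x \<in> H" for x
        using kernel_operator_finite_support[OF F, of f x ?p] that H
        by (auto simp: T_eq f_def)
      have "L2_set (\<lambda>x. cmod (\<Sum>y\<in>F. complex_of_real (?p x y) * u y)) H
            = L2_set (\<lambda>x. cmod (markov_operator G \<mu> f x)) H"
        by (rule L2_set_cong) (simp_all add: eq)
      also have "\<dots> \<le> ell2_norm ?A (markov_operator G \<mu> f)"
        by (intro L2_set_le_ell2_norm bounded_operator_closed[OF bounded_operator_markov[OF G(1-3)]] f H)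
      also have "\<dots> \<le> inverse ?R * ell2_norm ?A f"
        by (rule markov_operator_norm_le_finite_support[OF G F]) (simp add: f_def)
      also have "\<dots> \<le> inverse ?R * ell2_norm ?A u"
        using f R by (intro mult_left_mono) auto
      finally show ?thesis .
    qed
    thus "\<forall>\<^sub>F F in finite_subsets_at_top ?A.
        L2_set (\<lambda>x. cmod (\<Sum>y\<in>F. complex_of_real (?p x y) * u y)) H \<le> inverse ?R * ell2_norm ?A u"
      by (intro eventually_finite_subsets_at_top_weakI)
  qed simp
qed


section \<open>Invertibility of \<open>\<zeta> - T\<close> from quadratic forms\<close>

lemma self_adjoint_form_real:
  assumes sa: "\<And>u v. u \<in> ell2 A \<Longrightarrow> v \<in> ell2 A \<Longrightarrow> ell2_inner A (T u) v = ell2_inner A u (T v)"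
    and u: "u \<in> ell2 A"
  shows "Im (ell2_inner A (T u) u) = 0"
proof -
  have "Im (ell2_inner A (T u) u) = Im (cnj (ell2_inner A (T u) u))"
    using sa[OF u u] ell2_inner_commute[of A u "T u"] by simp
  thus ?thesis by simp
qed

text \<open>Multiplication by \<open>\<mp>\<i>\<close> turns \<open>\<zeta> - T\<close> into an operator with coercive real part, since
  \<open>\<langle>T u, u\<rangle>\<close> is real.\<close>

lemma self_adjoint_nonreal_resolvent:
  assumes T: "bounded_operator A T"
    and sa: "\<And>u v. u \<in> ell2 A \<Longrightarrow> v \<in> ell2 A \<Longrightarrow> ell2_inner A (T u) v = ell2_inner A u (T v)"
    and "Im \<zeta> \<noteq> 0"
  shows "\<zeta> \<in> resolvent_set A T"
proof -
  define \<omega> where "\<omega> = - \<i> * complex_of_real (sgn (Im \<zeta>))"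
  show ?thesis
  proof (rule resolvent_setI_coercive[OF T, where Q = "\<lambda>u x. \<omega> * u x" and c = "\<bar>Im \<zeta>\<bar>"])
    show "bounded_operator A (\<lambda>u x. \<omega> * u x)"
      using bounded_operator_lincomb[OF bounded_operator_id bounded_operator_id, of A \<omega> 0] by simp
    fix u assume u: "u \<in> ell2 A"
    have Tu: "T u \<in> ell2 A" by (rule bounded_operator_closed[OF T u])
    have eq: "(\<lambda>x. \<zeta> * (\<omega> * u x) - T (\<lambda>x. \<omega> * u x) x) = (\<lambda>x. \<omega> * (\<zeta> * u x - T u x))"
      by (simp add: bounded_operator_scale[OF T u] algebra_simps)
    show "(\<lambda>x. \<omega> * (\<zeta> * u x - T u x)) = (\<lambda>x. \<zeta> * (\<omega> * u x) - T (\<lambda>x. \<omega> * u x) x)"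
      by (rule eq[symmetric])
    have "ell2_inner A (\<lambda>x. \<omega> * (\<zeta> * u x - T u x)) u
          = \<omega> * (\<zeta> * of_real ((ell2_norm A u)\<^sup>2) - ell2_inner A (T u) u)"
      unfolding ell2_inner_scale_left ell2_inner_diff_left[OF ell2_scale[OF u] Tu u]
        ell2_inner_self[OF u] ..
    hence "Re (ell2_inner A (\<lambda>x. \<omega> * (\<zeta> * u x - T u x)) u) = \<bar>Im \<zeta>\<bar> * (ell2_norm A u)\<^sup>2"
      using self_adjoint_form_real[of A T, OF sa u]
      by (simp add: \<omega>_def sgn_if power2_eq_square)
    thus "\<bar>Im \<zeta>\<bar> * (ell2_norm A u)\<^sup>2
          \<le> Re (ell2_inner A (\<lambda>x. \<zeta> * (\<omega> * u x) - T (\<lambda>x. \<omega> * u x) x) u)"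
      by (simp add: eq)
  qed (use assms in simp)
qed

lemma real_above_norm_resolvent:
  assumes T: "bounded_operator A T"
    and le: "\<And>u. u \<in> ell2 A \<Longrightarrow> ell2_norm A (T u) \<le> \<rho> * ell2_norm A u" and "t > \<rho>"
  shows "complex_of_real t \<in> resolvent_set A T"
proof (rule resolvent_setI_coercive[OF T bounded_operator_id, where c = "t - \<rho>"])
  fix u assume u: "u \<in> ell2 A"
  have Tu: "T u \<in> ell2 A" by (rule bounded_operator_closed[OF T u])
  have "Re (ell2_inner A (T u) u) \<le> ell2_norm A (T u) * ell2_norm A u"
    using ell2_cauchy_schwarz[OF Tu u] complex_Re_le_cmod[of "ell2_inner A (T u) u"] by linarith
  also have "\<dots> \<le> \<rho> * (ell2_norm A u)\<^sup>2"
    using mult_right_mono[OF le[OF u] ell2_norm_nonneg[of A u]] by (simp add: power2_eq_square)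
  finally show "(t - \<rho>) * (ell2_norm A u)\<^sup>2
      \<le> Re (ell2_inner A (\<lambda>x. complex_of_real t * u x - T u x) u)"
    unfolding ell2_inner_diff_left[OF ell2_scale[OF u] Tu u] ell2_inner_scale_left ell2_inner_self[OF u]
    by (simp add: algebra_simps)
qed (use assms in simp_all)

text \<open>If \<open>T\<^sup>k \<ge> -c\<close> as a quadratic form and \<open>t\<^sup>k < -c\<close>, then \<open>T\<^sup>k - t\<^sup>k\<close> is coercive, and its
  factor \<open>t - T\<close> is invertible.\<close>

lemma real_power_form_bound_resolvent:
  assumes T: "bounded_operator A T"
    and form: "\<And>u. u \<in> ell2 A \<Longrightarrow> - c * (ell2_norm A u)\<^sup>2 \<le> Re (ell2_inner A ((T ^^ k) u) u)"
    and t: "t ^ k < - c"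
  shows "complex_of_real t \<in> resolvent_set A T"
proof -
  define \<zeta> where "\<zeta> = complex_of_real t"
  \<comment> \<open>\<open>Q\<close> is the cofactor in \<open>(\<zeta> - T) Q = T\<^sup>k - \<zeta>\<^sup>k\<close>.\<close>
  define Q where "Q u = (\<lambda>x. \<Sum>i<k. - (\<zeta> ^ (k - Suc i)) * (T ^^ i) u x)" for u
  have Tn: "bounded_operator A (T ^^ n)" for n by (rule bounded_operator_funpow[OF T])
  have Q: "bounded_operator A Q"
    unfolding Q_def[abs_def]
  proof (rule bounded_operator_sum_ops)
    show "bounded_operator A (\<lambda>u x. - (\<zeta> ^ (k - Suc i)) * (T ^^ i) u x)" for i
      using bounded_operator_lincomb[OF Tn Tn, of "- (\<zeta> ^ (k - Suc i))" i 0 0] by simp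
  qed
  have TQ: "T (Q u) = (\<lambda>x. \<Sum>i<k. - (\<zeta> ^ (k - Suc i)) * (T ^^ Suc i) u x)" if u: "u \<in> ell2 A" for u
    unfolding Q_def
    by (subst bounded_operator_sum[OF T])
       (simp_all only: ell2_scale bounded_operator_closed[OF Tn u] bounded_operator_scale[OF T]
         funpow.simps o_def)
  have QT: "Q (T u) = T (Q u)" if u: "u \<in> ell2 A" for u
    unfolding TQ[OF u] unfolding Q_def by (simp add: funpow_swap1)
  have factor: "(\<lambda>x. \<zeta> * Q u x - T (Q u) x) = (\<lambda>x. (T ^^ k) u x - \<zeta> ^ k * u x)" if u: "u \<in> ell2 A" for u
  proof
    fix x
    define g where "g i = \<zeta> ^ (k - i) * (T ^^ i) u x" for i
    have "\<zeta> * Q u x - T (Q u) x = (\<Sum>i<k. g (Suc i) - g i)"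
      unfolding TQ[OF u] unfolding Q_def sum_distrib_left sum_subtractf[symmetric]
    proof (rule sum.cong[OF refl])
      fix i assume "i \<in> {..<k}"
      hence "\<zeta> ^ (k - i) = \<zeta> * \<zeta> ^ (k - Suc i)"
        by (simp add: Suc_diff_Suc flip: power_Suc)
      thus "\<zeta> * (- (\<zeta> ^ (k - Suc i)) * (T ^^ i) u x) - - (\<zeta> ^ (k - Suc i)) * (T ^^ Suc i) u x
          = g (Suc i) - g i"
        by (simp add: g_def algebra_simps)
    qed
    also have "\<dots> = g k - g 0" by (rule sum_lessThan_telescope)
    finally show "\<zeta> * Q u x - T (Q u) x = (T ^^ k) u x - \<zeta> ^ k * u x" by (simp add: g_def)
  qed
  show ?thesis
    unfolding \<zeta>_def[symmetric]
  proof (rule resolvent_setI_coercive[OF T Q, where c = "- c - t ^ k"])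
    fix u assume u: "u \<in> ell2 A"
    show "Q (\<lambda>x. \<zeta> * u x - T u x) = (\<lambda>x. \<zeta> * Q u x - T (Q u) x)"
      by (simp only: bounded_operator_diff[OF Q ell2_scale[OF u] bounded_operator_closed[OF T u]]
          bounded_operator_scale[OF Q u] QT[OF u])
    have "ell2_inner A (\<lambda>x. (T ^^ k) u x - \<zeta> ^ k * u x) u
        = ell2_inner A ((T ^^ k) u) u - of_real (t ^ k * (ell2_norm A u)\<^sup>2)"
      unfolding ell2_inner_diff_left[OF bounded_operator_closed[OF Tn u] ell2_scale[OF u] u]
        ell2_inner_scale_left ell2_inner_self[OF u] by (simp add: \<zeta>_def)
    hence "Re (ell2_inner A (\<lambda>x. (T ^^ k) u x - \<zeta> ^ k * u x) u)
        = Re (ell2_inner A ((T ^^ k) u) u) - t ^ k * (ell2_norm A u)\<^sup>2"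
      by (simp only: minus_complex.sel Re_complex_of_real)
    thus "(- c - t ^ k) * (ell2_norm A u)\<^sup>2 \<le> Re (ell2_inner A (\<lambda>x. \<zeta> * Q u x - T (Q u) x) u)"
      unfolding factor[OF u] using form[OF u] by (simp add: left_diff_distrib)
  qed (use t in simp)
qed

section \<open>Holomorphic dependence of \<open>(I - zT)\<^sup>-\<^sup>1\<close> on \<open>z\<close>\<close>

text \<open>If \<open>H z\<close> is the inverse of \<open>I - zT\<close>, the resolvent identity \<open>H z - H w = (z - w) H z T H w\<close> and a
  bound for \<open>H z\<close> near \<open>w\<close> show that \<open>H w T H w\<close> is the derivative at \<open>w\<close>. The set \<open>D\<close> need not be
  open: all limits are taken within \<open>D\<close>.\<close>

lemma inverse_family_holomorphic:
  assumes T: "bounded_operator A T"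
    and H: "\<And>z. z \<in> D \<Longrightarrow> bounded_operator A (H z)"
    and left: "\<And>z u. z \<in> D \<Longrightarrow> u \<in> ell2 A \<Longrightarrow> H z (\<lambda>x. u x - z * T u x) = u"
    and right: "\<And>z u. z \<in> D \<Longrightarrow> u \<in> ell2 A \<Longrightarrow> (\<lambda>x. H z u x - z * T (H z u) x) = u"
    and f: "f \<in> ell2 A"
  shows "(\<lambda>z. H z f x) holomorphic_on D"
  unfolding holomorphic_on_def
proof
  fix w assume w: "w \<in> D"
  have resolvent_eq: "H z g x - H w g x = (z - w) * H z (T (H w g)) x"
    if z: "z \<in> D" and g: "g \<in> ell2 A" for z g x
  proof -
    have Hw: "H w g \<in> ell2 A" and THw: "T (H w g) \<in> ell2 A"
      by (intro bounded_operator_closed[OF T] bounded_operator_closed[OF H] w g)+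
    have "(\<lambda>x. H w g x - z * T (H w g) x) = (\<lambda>x. g x - (z - w) * T (H w g) x)"
      using right[OF w g] by (auto simp: fun_eq_iff algebra_simps)
    hence "H w g = H z (\<lambda>x. g x - (z - w) * T (H w g) x)"
      using left[OF z Hw] by simp
    also have "\<dots> = (\<lambda>x. H z g x - (z - w) * H z (T (H w g)) x)"
      by (simp only: bounded_operator_diff[OF H[OF z] g ell2_scale[OF THw]]
          bounded_operator_scale[OF H[OF z] THw])
    finally have "H w g x = H z g x - (z - w) * H z (T (H w g)) x" by (rule fun_cong)
    thus ?thesis by simp
  qed
  obtain K where K: "K > 0" "\<And>u. u \<in> ell2 A \<Longrightarrow> ell2_norm A (H w u) \<le> K * ell2_norm A u"
    using bounded_operator_bound[OF H[OF w]] by blast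
  obtain L where L: "L > 0" "\<And>u. u \<in> ell2 A \<Longrightarrow> ell2_norm A (T u) \<le> L * ell2_norm A u"
    using bounded_operator_bound[OF T] by blast
  have bound: "ell2_norm A (H z g) \<le> 2 * K * ell2_norm A g"
    if z: "z \<in> D" "dist z w < 1 / (2 * K * L)" and g: "g \<in> ell2 A" for z g
  proof -
    define u where "u = H z g"
    have u: "u \<in> ell2 A" unfolding u_def by (rule bounded_operator_closed[OF H[OF z(1)] g])
    have Tu: "T u \<in> ell2 A" by (rule bounded_operator_closed[OF T u])
    have "(\<lambda>x. u x - w * T u x) = (\<lambda>x. g x + (z - w) * T u x)"
      using right[OF z(1) g] by (auto simp: u_def fun_eq_iff algebra_simps)
    hence "u = H w (\<lambda>x. g x + (z - w) * T u x)"
      using left[OF w u] by simp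
    hence "ell2_norm A u \<le> K * ell2_norm A (\<lambda>x. g x + (z - w) * T u x)"
      using K(2)[OF ell2_add_mem[OF g ell2_scale[OF Tu]]] by metis
    also have "\<dots> \<le> K * (ell2_norm A g + cmod (z - w) * (L * ell2_norm A u))"
      using K(1) ell2_norm_triangle[OF g ell2_scale[OF Tu], of "z - w"]
        mult_left_mono[OF L(2)[OF u], of "cmod (z - w)"]
      by (intro mult_left_mono) (auto simp: ell2_norm_scale)
    also have "\<dots> = K * ell2_norm A g + (cmod (z - w) * (K * L)) * ell2_norm A u"
      by (simp add: algebra_simps)
    also have "\<dots> \<le> K * ell2_norm A g + (1 / 2) * ell2_norm A u"
      using z(2) K(1) L(1) by (intro add_left_mono mult_right_mono) (auto simp: dist_norm field_simps)
    finally show ?thesis by (simp add: u_def)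
  qed
  define g where "g = T (H w f)"
  define h where "h = T (H w g)"
  have g: "g \<in> ell2 A" and h: "h \<in> ell2 A"
    unfolding h_def g_def
    by (intro bounded_operator_closed[OF T] bounded_operator_closed[OF H[OF w]] f)+
  define d where "d = 1 / (2 * K * L)"
  have d: "d > 0" using K L by (simp add: d_def)
  have "((\<lambda>z. (H z f x - H w f x) / (z - w) - H w g x) \<longlongrightarrow> 0) (at w within D)"
  proof (rule Lim_null_comparison)
    show "\<forall>\<^sub>F z in at w within D. cmod ((H z f x - H w f x) / (z - w) - H w g x)
            \<le> cmod (z - w) * (2 * K * ell2_norm A h)"
      unfolding eventually_at
    proof (intro exI[of _ d] conjI d ballI impI)
      fix z assume z: "z \<in> D" and zw: "z \<noteq> w \<and> dist z w < d"
      have "(H z f x - H w f x) / (z - w) - H w g x = H z g x - H w g x"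
        using zw resolvent_eq[OF z f, of x] by (simp add: g_def)
      also have "cmod \<dots> = cmod (z - w) * cmod (H z h x)"
        using resolvent_eq[OF z g, of x] by (simp add: h_def norm_mult)
      also have "\<dots> \<le> cmod (z - w) * ell2_norm A (H z h)"
        by (intro mult_left_mono cmod_le_ell2_norm bounded_operator_closed[OF H[OF z] h]) simp
      also have "\<dots> \<le> cmod (z - w) * (2 * K * ell2_norm A h)"
        using zw by (intro mult_left_mono bound[OF z _ h]) (auto simp: d_def)
      finally show "cmod ((H z f x - H w f x) / (z - w) - H w g x)
            \<le> cmod (z - w) * (2 * K * ell2_norm A h)" .
    qed
    have "((\<lambda>z. cmod (z - w) * (2 * K * ell2_norm A h)) \<longlongrightarrow> cmod (w - w) * (2 * K * ell2_norm A h))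
            (at w within D)"
      by (intro tendsto_intros)
    thus "((\<lambda>z. cmod (z - w) * (2 * K * ell2_norm A h)) \<longlongrightarrow> 0) (at w within D)" by simp
  qed
  hence "((\<lambda>z. (H z f x - H w f x) / (z - w)) \<longlongrightarrow> H w g x) (at w within D)"
    by (rule LIM_zero_cancel)
  thus "(\<lambda>z. H z f x) field_differentiable at w within D"
    unfolding field_differentiable_def has_field_derivative_iff by blast
qed

lemma resolvent_set_inverse_one_minus:
  assumes T: "bounded_operator A T" and z: "z \<noteq> 0 \<Longrightarrow> inverse z \<in> resolvent_set A T"
  shows "\<exists>H. bounded_operator A H \<and>
    (\<forall>u\<in>ell2 A. H (\<lambda>x. u x - z * T u x) = u \<and> (\<lambda>x. H u x - z * T (H u) x) = u)"
proof (cases "z = 0")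
  case True
  then show ?thesis by (intro exI[of _ "\<lambda>u. u"]) (simp add: bounded_operator_id)
next
  case False
  then obtain S where S: "bounded_operator A S"
      "\<And>u. u \<in> ell2 A \<Longrightarrow> S (\<lambda>x. inverse z * u x - T u x) = u"
      "\<And>u. u \<in> ell2 A \<Longrightarrow> (\<lambda>x. inverse z * S u x - T (S u) x) = u"
    using z unfolding resolvent_set_def by blast
  define H where "H u = (\<lambda>x. inverse z * S u x)" for u
  have "bounded_operator A H"
    using bounded_operator_lincomb[OF S(1) S(1), of "inverse z" 0] by (simp add: H_def[abs_def])
  moreover have "H (\<lambda>x. u x - z * T u x) = u" if u: "u \<in> ell2 A" for u
  proof -
    have "(\<lambda>x. u x - z * T u x) = (\<lambda>x. z * (inverse z * u x - T u x))"
      using False by (simp add: right_diff_distrib flip: mult.assoc)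
    hence "S (\<lambda>x. u x - z * T u x) = (\<lambda>x. z * S (\<lambda>x. inverse z * u x - T u x) x)"
      by (simp only: bounded_operator_scale[OF S(1)] ell2_diff ell2_scale u
          bounded_operator_closed[OF T u])
    thus ?thesis using False by (simp add: H_def S(2)[OF u] flip: mult.assoc)
  qed
  moreover have "(\<lambda>x. H u x - z * T (H u) x) = u" if u: "u \<in> ell2 A" for u
  proof -
    have "H u x - z * T (H u) x = inverse z * S u x - T (S u) x" for x
      using False by (simp add: H_def bounded_operator_scale[OF T bounded_operator_closed[OF S(1) u]])
    thus ?thesis using S(3)[OF u] by simp
  qed
  ultimately show ?thesis by blast
qed

text \<open>Inside the disc of radius \<open>1/\<rho>\<close> the solution of \<open>u - z T u = f\<close> is given by the Neumann series,
  because \<open>u = (\<Sum>n<N. z\<^sup>n T\<^sup>n f) + z\<^sup>N T\<^sup>N u\<close>.\<close>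

lemma one_minus_solution_sums:
  assumes T: "bounded_operator A T"
    and le: "\<And>u. u \<in> ell2 A \<Longrightarrow> ell2_norm A (T u) \<le> \<rho> * ell2_norm A u" and "\<rho> \<ge> 0"
    and z: "cmod z * \<rho> < 1" and u: "u \<in> ell2 A" and f: "f \<in> ell2 A"
    and eq: "(\<lambda>x. u x - z * T u x) = f"
  shows "(\<lambda>n. z ^ n * (T ^^ n) f x) sums u x"
proof -
  have Tn: "bounded_operator A (T ^^ n)" for n by (rule bounded_operator_funpow[OF T])
  have Tnf: "(T ^^ n) f = (\<lambda>x. (T ^^ n) u x - z * (T ^^ Suc n) u x)" for n
    unfolding eq[symmetric]
      bounded_operator_diff[OF Tn u ell2_scale[OF bounded_operator_closed[OF T u]]]
      bounded_operator_scale[OF Tn bounded_operator_closed[OF T u]]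
    by (simp add: funpow_swap1)
  have partial: "(\<Sum>n<N. z ^ n * (T ^^ n) f x) = u x - z ^ N * (T ^^ N) u x" for N
    by (induction N) (simp_all add: Tnf algebra_simps)
  have "(\<lambda>N. z ^ N * (T ^^ N) u x) \<longlonglongrightarrow> 0"
  proof (rule Lim_null_comparison)
    show "\<forall>\<^sub>F N in sequentially. cmod (z ^ N * (T ^^ N) u x) \<le> (cmod z * \<rho>) ^ N * ell2_norm A u"
    proof (intro always_eventually allI)
      fix N
      have "cmod ((T ^^ N) u x) \<le> \<rho> ^ N * ell2_norm A u"
        using cmod_le_ell2_norm[OF bounded_operator_closed[OF Tn u]]
          ell2_norm_funpow_le[OF T le \<open>\<rho> \<ge> 0\<close> u] by (rule order_trans)
      from mult_left_mono[OF this, of "cmod z ^ N"]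
      show "cmod (z ^ N * (T ^^ N) u x) \<le> (cmod z * \<rho>) ^ N * ell2_norm A u"
        by (simp add: norm_mult norm_power power_mult_distrib mult.assoc)
    qed
    show "(\<lambda>N. (cmod z * \<rho>) ^ N * ell2_norm A u) \<longlonglongrightarrow> 0"
      using z \<open>\<rho> \<ge> 0\<close> by (intro tendsto_mult_left_zero LIMSEQ_power_zero) (simp add: abs_mult)
  qed
  from tendsto_diff[OF tendsto_const this, of "u x"] show ?thesis
    unfolding sums_def partial by simp
qed

section \<open>The spectral gap and the Green functions\<close>

lemma aperiodic_odd_return:
  assumes "aperiodic_walk G \<mu>"
  obtains k where "odd k" "walk_prob G \<mu> k \<one>\<^bsub>G\<^esub> \<one>\<^bsub>G\<^esub> > 0"
proof -
  let ?S = "{n. n \<ge> 1 \<and> walk_prob G \<mu> n \<one>\<^bsub>G\<^esub> \<one>\<^bsub>G\<^esub> > 0}"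
  have "\<not> (\<forall>n\<in>?S. even n)"
  proof
    assume "\<forall>n\<in>?S. even n"
    hence "2 dvd Gcd ?S" by (intro Gcd_greatest) auto
    thus False using assms by (simp add: aperiodic_walk_def)
  qed
  thus ?thesis using that by blast
qed

text \<open>The step where aperiodicity enters: for \<open>k\<close> with \<open>p\<^sup>k(1,1) = \<delta> > 0\<close> the quadratic form of \<open>T\<^sup>k\<close>
  stays above \<open>- (\<rho>\<^sup>k - \<delta>)\<close>, and for odd \<open>k\<close> this is a gap for \<open>T\<close> itself at \<open>-\<rho>\<close>.\<close>

lemma markov_power_form_bound:
  assumes G: "group G" "set_pmf \<mu> \<subseteq> carrier G" "symmetric_walk G \<mu>" "irreducible_walk G \<mu>"
    and \<delta>: "\<delta> = walk_prob G \<mu> k \<one>\<^bsub>G\<^esub> \<one>\<^bsub>G\<^esub>" and \<rho>: "\<rho> = inverse (green_radius G \<mu>)" "\<rho> \<ge> 0"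
    and u: "u \<in> ell2 (carrier G)"
  shows "- (\<rho> ^ k - \<delta>) * (ell2_norm (carrier G) u)\<^sup>2
         \<le> Re (ell2_inner (carrier G) ((markov_operator G \<mu> ^^ k) u) u)"
proof -
  let ?A = "carrier G" and ?K = "kernel_operator (carrier G) (walk_prob G \<mu> k)"
  have T: "bounded_operator ?A (markov_operator G \<mu>)" by (rule bounded_operator_markov[OF G(1-3)])
  note pow = markov_operator_funpow[OF G(1,2), of _ k, symmetric]
  have "cmod (ell2_inner ?A (?K u) u - of_real (\<delta> * (ell2_norm ?A u)\<^sup>2))
        \<le> (\<rho> ^ k - \<delta>) * (ell2_norm ?A u)\<^sup>2"
  proof (rule positive_diagonal_form_bound[OF walk_prob_stochastic[OF G(1,2)] _ _ _ u])
    show "walk_prob G \<mu> k x x = \<delta>" if "x \<in> ?A" for x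
      unfolding \<delta> by (rule walk_prob_diagonal[OF G(1,2) that])
    fix v assume v: "v \<in> ell2 ?A"
    show "?K v \<in> ell2 ?A"
      unfolding pow[OF v] by (rule bounded_operator_closed[OF bounded_operator_funpow[OF T] v])
    show "ell2_norm ?A (?K v) \<le> \<rho> ^ k * ell2_norm ?A v"
      unfolding pow[OF v] using markov_operator_norm_le[OF G] \<rho>
      by (intro ell2_norm_funpow_le[OF T _ _ v]) auto
  qed
  moreover have "\<delta> * (ell2_norm ?A u)\<^sup>2 \<ge> 0" by (simp add: \<delta> walk_prob_nonneg)
  moreover have "\<bar>Re (ell2_inner ?A (?K u) u - of_real (\<delta> * (ell2_norm ?A u)\<^sup>2))\<bar>
      \<le> cmod (ell2_inner ?A (?K u) u - of_real (\<delta> * (ell2_norm ?A u)\<^sup>2))"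
    by (rule abs_Re_le_cmod)
  ultimately show ?thesis
    unfolding pow[OF u, symmetric] minus_complex.sel Re_complex_of_real by linarith
qed

lemma spectral_gap_parameter:
  fixes \<rho> \<delta> :: real
  assumes "\<delta> > 0"
  shows "\<exists>\<epsilon>>0. \<rho> ^ k - \<delta> < (\<rho> * inverse (1 + \<epsilon>)) ^ k"
proof -
  have "((\<lambda>e. (\<rho> * inverse (1 + e)) ^ k) \<longlongrightarrow> (\<rho> * inverse (1 + 0)) ^ k) (at_right 0)"
    by (intro tendsto_intros) auto
  hence "\<forall>\<^sub>F e in at_right 0. \<rho> ^ k - \<delta> < (\<rho> * inverse (1 + e)) ^ k"
    by (rule order_tendstoD) (use assms in simp)
  moreover have "\<forall>\<^sub>F e in at_right (0::real). e > 0" by (simp add: eventually_at_right_less)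
  ultimately have "\<forall>\<^sub>F e in at_right 0. e > 0 \<and> \<rho> ^ k - \<delta> < (\<rho> * inverse (1 + e)) ^ k"
    by eventually_elim auto
  thus ?thesis using eventually_happens'[OF trivial_limit_at_right_real] by blast
qed

lemma inverse_not_in_interval:
  assumes R: "R > 0" and \<epsilon>: "\<epsilon> > (0::real)" and "z \<noteq> 0"
    and z: "z \<notin> complex_of_real ` ({.. - (R * (1 + \<epsilon>))} \<union> {R ..})"
  shows "inverse z \<notin> complex_of_real ` {- (inverse R * inverse (1 + \<epsilon>)) .. inverse R}"
proof
  assume "inverse z \<in> complex_of_real ` {- (inverse R * inverse (1 + \<epsilon>)) .. inverse R}"
  then obtain t where t: "inverse z = complex_of_real t"
    "- (inverse R * inverse (1 + \<epsilon>)) \<le> t" "t \<le> inverse R" by auto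
  have zt: "z = complex_of_real (inverse t)"
    by (metis t(1) inverse_inverse_eq of_real_inverse)
  have "t \<noteq> 0" using t(1) \<open>z \<noteq> 0\<close> by auto
  have "inverse t \<le> - (R * (1 + \<epsilon>)) \<or> R \<le> inverse t"
  proof (cases "t > 0")
    case True
    then show ?thesis using le_imp_inverse_le[OF t(3)] R by simp
  next
    case False
    hence t0: "0 < - t" using \<open>t \<noteq> 0\<close> by simp
    have "- t \<le> inverse (R * (1 + \<epsilon>))" using t(2) by (simp add: inverse_mult_distrib)
    hence "inverse (inverse (R * (1 + \<epsilon>))) \<le> inverse (- t)" by (rule le_imp_inverse_le[OF _ t0])
    thus ?thesis by simp
  qed
  hence "inverse t \<in> {.. - (R * (1 + \<epsilon>))} \<union> {R ..}" by simp
  thus False using z unfolding zt by blast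
qed

theorem theorem9p3:
  fixes G :: "('a, 'b) monoid_scheme" and \<mu> :: "'a pmf" and R :: real
  assumes "group G" and "countable (carrier G)"
    and "set_pmf \<mu> \<subseteq> carrier G"
    and "symmetric_walk G \<mu>" and "irreducible_walk G \<mu>" and "aperiodic_walk G \<mu>"
    and "R = green_radius G \<mu>"
  shows "\<exists>\<epsilon>>0.
     spectrum (carrier G) (markov_operator G \<mu>)
       \<subseteq> complex_of_real ` {- (inverse R * inverse (1 + \<epsilon>)) .. inverse R} \<and>
     (\<forall>x\<in>carrier G. \<forall>y\<in>carrier G.
        \<exists>F. F holomorphic_on (UNIV - complex_of_real ` ({.. - (R * (1 + \<epsilon>))} \<union> {R ..})) \<and>
            (\<forall>z. cmod z < R \<longrightarrow> F z = green G \<mu> z x y))"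
proof -
  let ?A = "carrier G" and ?T = "markov_operator G \<mu>"
  note G = assms(1,3,4,5)
  have one: "\<one>\<^bsub>G\<^esub> \<in> ?A" by (rule monoid.one_closed[OF group.is_monoid[OF assms(1)]])
  have R: "R \<ge> 1" using conv_radius_green(2)[OF assms(1,5) one one] assms(7) by simp
  define \<rho> where "\<rho> = inverse R"
  have \<rho>: "\<rho> > 0" using R by (simp add: \<rho>_def)
  have T: "bounded_operator ?A ?T" by (rule bounded_operator_markov[OF G(1-3)])
  have norm_le: "ell2_norm ?A (?T u) \<le> \<rho> * ell2_norm ?A u" if "u \<in> ell2 ?A" for u
    using markov_operator_norm_le[OF G that] by (simp add: \<rho>_def assms(7))
  obtain k where k: "odd k" "walk_prob G \<mu> k \<one>\<^bsub>G\<^esub> \<one>\<^bsub>G\<^esub> > 0"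
    using aperiodic_odd_return[OF assms(6)] by blast
  define \<delta> where "\<delta> = walk_prob G \<mu> k \<one>\<^bsub>G\<^esub> \<one>\<^bsub>G\<^esub>"
  obtain \<epsilon> where \<epsilon>: "\<epsilon> > 0" "\<rho> ^ k - \<delta> < (\<rho> * inverse (1 + \<epsilon>)) ^ k"
    using spectral_gap_parameter[of \<delta> \<rho> k] k by (auto simp: \<delta>_def)
  define a where "a = \<rho> * inverse (1 + \<epsilon>)"
  have a: "a > 0" using \<rho> \<epsilon> by (simp add: a_def)
  have resolvent: "\<zeta> \<in> resolvent_set ?A ?T" if \<zeta>: "\<zeta> \<notin> complex_of_real ` {- a .. \<rho>}" for \<zeta>
  proof (cases "Im \<zeta> = 0")
    case False
    show ?thesis
      by (rule self_adjoint_nonreal_resolvent[OF T markov_operator_self_adjoint[OF G(1-3)] False])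
  next
    case True
    define t where "t = Re \<zeta>"
    have \<zeta>_eq: "\<zeta> = complex_of_real t" using True by (simp add: t_def complex_eq_iff)
    have "t > \<rho> \<or> t < - a" using \<zeta> by (force simp: \<zeta>_eq)
    thus ?thesis
    proof
      assume "t > \<rho>"
      thus ?thesis unfolding \<zeta>_eq by (intro real_above_norm_resolvent[OF T norm_le])
    next
      assume "t < - a"
      \<comment> \<open>Since \<open>k\<close> is odd, \<open>t\<^sup>k\<close> lies below the quadratic form of \<open>T\<^sup>k\<close>.\<close>
      hence "a ^ k < (- t) ^ k" using a k(1) by (intro power_strict_mono) (auto simp: odd_pos)
      hence lt: "t ^ k < - (\<rho> ^ k - \<delta>)" using \<epsilon>(2) k(1) by (simp add: a_def)
      have form: "- (\<rho> ^ k - \<delta>) * (ell2_norm ?A u)\<^sup>2 \<le> Re (ell2_inner ?A ((?T ^^ k) u) u)"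
        if "u \<in> ell2 ?A" for u
        by (rule markov_power_form_bound[OF G \<delta>_def _ _ that]) (use \<rho> in \<open>simp_all add: \<rho>_def assms(7)\<close>)
      show ?thesis
        unfolding \<zeta>_eq by (rule real_power_form_bound_resolvent[OF T form lt])
    qed
  qed
  define D where "D = UNIV - complex_of_real ` ({.. - (R * (1 + \<epsilon>))} \<union> {R ..})"
  have "\<forall>z\<in>D. \<exists>H. bounded_operator ?A H \<and>
      (\<forall>u\<in>ell2 ?A. H (\<lambda>x. u x - z * ?T u x) = u \<and> (\<lambda>x. H u x - z * ?T (H u) x) = u)"
  proof (intro ballI resolvent_set_inverse_one_minus[OF T] resolvent)
    fix z assume z: "z \<in> D" and "z \<noteq> 0"
    thus "inverse z \<notin> complex_of_real ` {- a .. \<rho>}"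
      unfolding a_def \<rho>_def by (intro inverse_not_in_interval) (use R \<epsilon> z in \<open>auto simp: D_def\<close>)
  qed
  from bchoice[OF this] obtain H where H: "\<And>z. z \<in> D \<Longrightarrow> bounded_operator ?A (H z)"
      "\<And>z u. z \<in> D \<Longrightarrow> u \<in> ell2 ?A \<Longrightarrow> H z (\<lambda>x. u x - z * ?T u x) = u"
      "\<And>z u. z \<in> D \<Longrightarrow> u \<in> ell2 ?A \<Longrightarrow> (\<lambda>x. H z u x - z * ?T (H z u) x) = u"
    by blast
  have green: "\<exists>F. F holomorphic_on D \<and> (\<forall>z. cmod z < R \<longrightarrow> F z = green G \<mu> z x y)"
    if x: "x \<in> ?A" and y: "y \<in> ?A" for x y
  proof -
    define f where "f = (\<lambda>v. if v = y then 1 else 0 :: complex)"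
    have f: "f \<in> ell2 ?A"
      using y by (auto simp: ell2_def f_def intro!: finite_nonzero_values_imp_summable_on
          finite_subset[of _ "{y}"] split: if_splits)
    have "H z f x = green G \<mu> z x y" if z: "cmod z < R" for z
    proof -
      have zD: "z \<in> D"
      proof -
        have "cmod (complex_of_real s) \<ge> R" if "s \<in> {.. - (R * (1 + \<epsilon>))} \<union> {R ..}" for s
        proof -
          have "R \<le> R * (1 + \<epsilon>)" using R \<epsilon> by (simp add: algebra_simps)
          moreover have "s \<le> - (R * (1 + \<epsilon>)) \<or> R \<le> s" using that by auto
          ultimately show ?thesis unfolding norm_of_real by linarith
        qed
        thus ?thesis using z by (force simp: D_def)
      qed
      have "cmod z * \<rho> < 1" using z R by (simp add: \<rho>_def field_simps)
      hence "(\<lambda>n. z ^ n * (?T ^^ n) f x) sums H z f x"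
        using one_minus_solution_sums[OF T norm_le _ _ bounded_operator_closed[OF H(1)[OF zD] f] f
            H(3)[OF zD f]] \<rho> by simp
      moreover have "(?T ^^ n) f x = complex_of_real (walk_prob G \<mu> n x y)" for n
        unfolding markov_operator_funpow[OF G(1,2) f]
        by (subst kernel_operator_finite_support[of "{y}"]) (use x y in \<open>simp_all add: f_def\<close>)
      ultimately show ?thesis unfolding green_def by (simp add: sums_iff)
    qed
    moreover have "(\<lambda>z. H z f x) holomorphic_on D"
      by (rule inverse_family_holomorphic[OF T H f])
    ultimately show ?thesis by blast
  qed
  show ?thesis
  proof (intro exI[of _ \<epsilon>] conjI ballI \<epsilon>(1))
    show "spectrum ?A ?T \<subseteq> complex_of_real ` {- (inverse R * inverse (1 + \<epsilon>)) .. inverse R}"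
      using resolvent unfolding spectrum_def a_def \<rho>_def by blast
    show "\<exists>F. F holomorphic_on (UNIV - complex_of_real ` ({.. - (R * (1 + \<epsilon>))} \<union> {R ..})) \<and>
            (\<forall>z. cmod z < R \<longrightarrow> F z = green G \<mu> z x y)" if "x \<in> ?A" "y \<in> ?A" for x y
      using green[OF that] unfolding D_def .
  qed
qed

end
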